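(* Let $\pi$ be a groupoid, let $V$ be a $\pi$-graded vector space of finite type over $\mathbb{C}$, and let $f:\mathrm{Ob}(\pi)\to\mathbb{C}\setminus\{0\}$. Suppose that, for every $a\in\mathrm{Ob}(\pi)$, an invertible operator $\sigma(a)\in\bigoplus_{\alpha\in s^{-1}(a)}\mathrm{End}_{\mathbb{C}}\big((V\otimes V)_\alpha\big)$ is given, such that for all $a\in\mathrm{Ob}(\pi)$ $$\sigma^{(12)}(a)\,\sigma^{(23)}(ah^{(1)})\,\sigma^{(12)}(a)=\sigma^{(23)}(ah^{(1)})\,\sigma^{(12)}(a)\,\sigma^{(23)}(ah^{(1)}),\qquad \sigma(a)+\sigma^{-1}(a)=f(a)\,\mathrm{id}.$$ Suppose moreover that $f(a)=f(b)$ whenever there exists an arrow $\alpha\in\pi$ with $s(\alpha)=a$, $t(\alpha)=b$. Then the operator $$\check R(z,a)=e^{z}\sigma(a)+e^{-z}\sigma^{-1}(a)$$ satisfies the dynamical Yang--Baxter equation: for all $a\in\mathrm{Ob}(\pi)$ and $z,w\in\mathbb{C}$, $$\check R^{(23)}(z-w,ah^{(1)})\,\check R^{(12)}(z,a)\,\check R^{(23)}(w,ah^{(1)})=\check R^{(12)}(w,a)\,\check R^{(23)}(z,ah^{(1)})\,\check R^{(12)}(z-w,a).$$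
   Context: A groupoid $\pi$ is a small category in which every morphism (arrow) is invertible; $s,t:\pi\to\mathrm{Ob}(\pi)$ are source and target, and $\beta\circ\alpha$ is defined when $t(\alpha)=s(\beta)$. A $\pi$-graded vector space of finite type over $\mathbb{C}$ is a collection $V=(V_\alpha)_{\alpha\in\pi}$ of finite dimensional vector spaces indexed by the arrows such that for each object $a$ there are only finitely many arrows $\alpha$ with source or target $a$ and $V_\alpha\neq0$. Tensor products are defined by $(V\otimes W)_\gamma=\bigoplus_{\beta\circ\alpha=\gamma}V_\alpha\otimes W_\beta$. For a family $X(a)\in\bigoplus_{\alpha\in s^{-1}(a)}\mathrm{End}_{\mathbb{C}}((V\otimes V)_\alpha)$, $a\in\mathrm{Ob}(\pi)$, and for $u\otimes v\otimes w\in V_{\alpha_1}\otimes V_{\alpha_2}\otimes V_{\alpha_3}$ with $\alpha_1,\alpha_2,\alpha_3$ composable and $s(\alpha_1)=a$, set $X^{(12)}(a)(u\otimes v\otimes w)=X(a)(u\otimes v)\otimes w$ and $X^{(23)}(ah^{(1)})(u\otimes v\otimes w)=u\otimes X(t(\alpha_1))(v\otimes w)$. These act on the source fiber $\bigoplus_{\alpha\in s^{-1}(a)}(V\otimes V\otimes V)_\alpha$. *)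

theory Defs
  imports Complex_Main "HOL-Library.Function_Algebras"
begin

section \<open>Groupoids\<close>

record ('o, 'm) groupoid_data =
  Ob :: "'o set"
  Arr :: "'m set"
  src :: "'m \<Rightarrow> 'o"
  tgt :: "'m \<Rightarrow> 'o"
  ident :: "'o \<Rightarrow> 'm"
  cmp :: "'m \<Rightarrow> 'm \<Rightarrow> 'm"

text \<open>\<open>cmp \<pi> \<beta> \<alpha>\<close> is the composite "\<open>\<beta>\<close> after \<open>\<alpha>\<close>", meaningful when \<open>tgt \<pi> \<alpha> = src \<pi> \<beta>\<close>.\<close>

locale groupoid =
  fixes \<pi> :: "('o, 'm) groupoid_data"
  assumes src_in: "\<alpha> \<in> Arr \<pi> \<Longrightarrow> src \<pi> \<alpha> \<in> Ob \<pi>"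
    and tgt_in: "\<alpha> \<in> Arr \<pi> \<Longrightarrow> tgt \<pi> \<alpha> \<in> Ob \<pi>"
    and ident_in: "a \<in> Ob \<pi> \<Longrightarrow> ident \<pi> a \<in> Arr \<pi>"
    and src_ident: "a \<in> Ob \<pi> \<Longrightarrow> src \<pi> (ident \<pi> a) = a"
    and tgt_ident: "a \<in> Ob \<pi> \<Longrightarrow> tgt \<pi> (ident \<pi> a) = a"
    and cmp_in: "\<lbrakk>\<alpha> \<in> Arr \<pi>; \<beta> \<in> Arr \<pi>; tgt \<pi> \<alpha> = src \<pi> \<beta>\<rbrakk> \<Longrightarrow> cmp \<pi> \<beta> \<alpha> \<in> Arr \<pi>"
    and src_cmp: "\<lbrakk>\<alpha> \<in> Arr \<pi>; \<beta> \<in> Arr \<pi>; tgt \<pi> \<alpha> = src \<pi> \<beta>\<rbrakk> \<Longrightarrow> src \<pi> (cmp \<pi> \<beta> \<alpha>) = src \<pi> \<alpha>"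
    and tgt_cmp: "\<lbrakk>\<alpha> \<in> Arr \<pi>; \<beta> \<in> Arr \<pi>; tgt \<pi> \<alpha> = src \<pi> \<beta>\<rbrakk> \<Longrightarrow> tgt \<pi> (cmp \<pi> \<beta> \<alpha>) = tgt \<pi> \<beta>"
    and cmp_ident_right: "\<alpha> \<in> Arr \<pi> \<Longrightarrow> cmp \<pi> \<alpha> (ident \<pi> (src \<pi> \<alpha>)) = \<alpha>"
    and cmp_ident_left: "\<alpha> \<in> Arr \<pi> \<Longrightarrow> cmp \<pi> (ident \<pi> (tgt \<pi> \<alpha>)) \<alpha> = \<alpha>"
    and cmp_assoc: "\<lbrakk>\<alpha> \<in> Arr \<pi>; \<beta> \<in> Arr \<pi>; \<gamma> \<in> Arr \<pi>; tgt \<pi> \<alpha> = src \<pi> \<beta>; tgt \<pi> \<beta> = src \<pi> \<gamma>\<rbrakk>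
      \<Longrightarrow> cmp \<pi> \<gamma> (cmp \<pi> \<beta> \<alpha>) = cmp \<pi> (cmp \<pi> \<gamma> \<beta>) \<alpha>"
    and inverse_arrow: "\<alpha> \<in> Arr \<pi> \<Longrightarrow>
      \<exists>\<beta>\<in>Arr \<pi>. src \<pi> \<beta> = tgt \<pi> \<alpha> \<and> tgt \<pi> \<beta> = src \<pi> \<alpha> \<and>
        cmp \<pi> \<beta> \<alpha> = ident \<pi> (src \<pi> \<alpha>) \<and> cmp \<pi> \<alpha> \<beta> = ident \<pi> (tgt \<pi> \<alpha>)"

definition source_fiber :: "('o, 'm) groupoid_data \<Rightarrow> 'o \<Rightarrow> 'm set" where
  "source_fiber \<pi> a = {\<alpha> \<in> Arr \<pi>. src \<pi> \<alpha> = a}"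

section \<open>Graded vector spaces of finite type\<close>

text \<open>
  The spaces \<open>V \<alpha>\<close> are linear subspaces of one ambient complex vector space \<open>('v, sc)\<close> of
  arbitrary dimension. No relation between different \<open>V \<alpha>\<close> is imposed; every family of vector
  spaces is of this form (embed each member in the direct sum of the family).
\<close>

definition graded_finite_type ::
  "('o, 'm) groupoid_data \<Rightarrow> (complex \<Rightarrow> 'v \<Rightarrow> 'v::ab_group_add) \<Rightarrow> ('m \<Rightarrow> 'v set) \<Rightarrow> bool" where
  "graded_finite_type \<pi> sc V \<longleftrightarrow>
     vector_space sc \<and>
     (\<forall>\<alpha>\<in>Arr \<pi>. module.subspace sc (V \<alpha>) \<and> (\<exists>B. finite B \<and> module.span sc B = V \<alpha>)) \<and>
     (\<forall>a\<in>Ob \<pi>. finite {\<alpha> \<in> Arr \<pi>. (src \<pi> \<alpha> = a \<or> tgt \<pi> \<alpha> = a) \<and> V \<alpha> \<noteq> {0}})"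

section \<open>Tensor products\<close>

text \<open>
  The pure tensor of \<open>u\<close> and \<open>v\<close> is realised as evaluation \<open>B \<mapsto> B u v\<close> on bilinear forms, and
  \<open>U \<otimes> W\<close> as the span of the pure tensors with \<open>u \<in> U\<close>, \<open>v \<in> W\<close>. Over a field this is a model of
  the algebraic tensor product, since bilinear forms separate its points and every bilinear
  form on \<open>U \<times> W\<close> extends to the ambient space. Threefold products use trilinear forms, which
  makes the associativity isomorphisms identities. The value \<open>0\<close> at functions that are not
  multilinear is a dummy.
\<close>

type_synonym 'v tens2 = "('v \<Rightarrow> 'v \<Rightarrow> complex) \<Rightarrow> complex"
type_synonym 'v tens3 = "('v \<Rightarrow> 'v \<Rightarrow> 'v \<Rightarrow> complex) \<Rightarrow> complex"

definition bilinear_form :: "(complex \<Rightarrow> 'v \<Rightarrow> 'v::ab_group_add) \<Rightarrow> ('v \<Rightarrow> 'v \<Rightarrow> complex) \<Rightarrow> bool" where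
  "bilinear_form sc B \<longleftrightarrow>
     (\<forall>v. Vector_Spaces.linear sc (*) (\<lambda>u. B u v)) \<and> (\<forall>u. Vector_Spaces.linear sc (*) (\<lambda>v. B u v))"

definition trilinear_form ::
  "(complex \<Rightarrow> 'v \<Rightarrow> 'v::ab_group_add) \<Rightarrow> ('v \<Rightarrow> 'v \<Rightarrow> 'v \<Rightarrow> complex) \<Rightarrow> bool" where
  "trilinear_form sc T \<longleftrightarrow>
     (\<forall>v w. Vector_Spaces.linear sc (*) (\<lambda>u. T u v w)) \<and>
     (\<forall>u w. Vector_Spaces.linear sc (*) (\<lambda>v. T u v w)) \<and>
     (\<forall>u v. Vector_Spaces.linear sc (*) (\<lambda>w. T u v w))"

definition tensor2 :: "(complex \<Rightarrow> 'v \<Rightarrow> 'v::ab_group_add) \<Rightarrow> 'v \<Rightarrow> 'v \<Rightarrow> 'v tens2" where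
  "tensor2 sc u v = (\<lambda>B. if bilinear_form sc B then B u v else 0)"

definition tensor3 :: "(complex \<Rightarrow> 'v \<Rightarrow> 'v::ab_group_add) \<Rightarrow> 'v \<Rightarrow> 'v \<Rightarrow> 'v \<Rightarrow> 'v tens3" where
  "tensor3 sc u v w = (\<lambda>T. if trilinear_form sc T then T u v w else 0)"

definition tscale :: "complex \<Rightarrow> ('k \<Rightarrow> complex) \<Rightarrow> 'k \<Rightarrow> complex" where
  "tscale c x = (\<lambda>k. c * x k)"

definition tensor_space2 ::
  "(complex \<Rightarrow> 'v \<Rightarrow> 'v::ab_group_add) \<Rightarrow> 'v set \<Rightarrow> 'v set \<Rightarrow> 'v tens2 set" where
  "tensor_space2 sc U V = module.span tscale {tensor2 sc u v | u v. u \<in> U \<and> v \<in> V}"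

definition tensor_space3 ::
  "(complex \<Rightarrow> 'v \<Rightarrow> 'v::ab_group_add) \<Rightarrow> 'v set \<Rightarrow> 'v set \<Rightarrow> 'v set \<Rightarrow> 'v tens3 set" where
  "tensor_space3 sc U V W =
     module.span tscale {tensor3 sc u v w | u v w. u \<in> U \<and> v \<in> V \<and> w \<in> W}"

text \<open>
  An element of a degree of a graded tensor product is a finitely supported family of tensors,
  indexed by the composable tuples of arrows with the prescribed composite (extended by zero).
\<close>

definition composable2 :: "('o, 'm) groupoid_data \<Rightarrow> 'm \<Rightarrow> 'm \<Rightarrow> bool" where
  "composable2 \<pi> \<alpha> \<beta> \<longleftrightarrow> \<alpha> \<in> Arr \<pi> \<and> \<beta> \<in> Arr \<pi> \<and> tgt \<pi> \<alpha> = src \<pi> \<beta>"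

definition composable3 :: "('o, 'm) groupoid_data \<Rightarrow> 'm \<Rightarrow> 'm \<Rightarrow> 'm \<Rightarrow> bool" where
  "composable3 \<pi> \<alpha>\<^sub>1 \<alpha>\<^sub>2 \<alpha>\<^sub>3 \<longleftrightarrow> composable2 \<pi> \<alpha>\<^sub>1 \<alpha>\<^sub>2 \<and> composable2 \<pi> \<alpha>\<^sub>2 \<alpha>\<^sub>3"

type_synonym ('m, 'v) gtens2 = "'m \<times> 'm \<Rightarrow> 'v tens2"
type_synonym ('m, 'v) gtens3 = "'m \<times> 'm \<times> 'm \<Rightarrow> 'v tens3"

definition graded_tensor2 ::
  "('o, 'm) groupoid_data \<Rightarrow> (complex \<Rightarrow> 'v \<Rightarrow> 'v::ab_group_add) \<Rightarrow>
   ('m \<Rightarrow> 'v set) \<Rightarrow> ('m \<Rightarrow> 'v set) \<Rightarrow> 'm \<Rightarrow> ('m, 'v) gtens2 set" where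
  "graded_tensor2 \<pi> sc V W \<gamma> =
     {x. finite {p. x p \<noteq> 0} \<and>
         (\<forall>\<alpha> \<beta>. x (\<alpha>, \<beta>) \<in> (if composable2 \<pi> \<alpha> \<beta> \<and> cmp \<pi> \<beta> \<alpha> = \<gamma>
                             then tensor_space2 sc (V \<alpha>) (W \<beta>) else {0}))}"

definition graded_tensor3 ::
  "('o, 'm) groupoid_data \<Rightarrow> (complex \<Rightarrow> 'v \<Rightarrow> 'v::ab_group_add) \<Rightarrow>
   ('m \<Rightarrow> 'v set) \<Rightarrow> ('m \<Rightarrow> 'v set) \<Rightarrow> ('m \<Rightarrow> 'v set) \<Rightarrow> 'm \<Rightarrow> ('m, 'v) gtens3 set" where
  "graded_tensor3 \<pi> sc U V W \<gamma> =
     {x. finite {p. x p \<noteq> 0} \<and>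
         (\<forall>\<alpha>\<^sub>1 \<alpha>\<^sub>2 \<alpha>\<^sub>3. x (\<alpha>\<^sub>1, \<alpha>\<^sub>2, \<alpha>\<^sub>3) \<in>
            (if composable3 \<pi> \<alpha>\<^sub>1 \<alpha>\<^sub>2 \<alpha>\<^sub>3 \<and> cmp \<pi> \<alpha>\<^sub>3 (cmp \<pi> \<alpha>\<^sub>2 \<alpha>\<^sub>1) = \<gamma>
             then tensor_space3 sc (U \<alpha>\<^sub>1) (V \<alpha>\<^sub>2) (W \<alpha>\<^sub>3) else {0}))}"

definition gscale :: "complex \<Rightarrow> ('i \<Rightarrow> 'k \<Rightarrow> complex) \<Rightarrow> 'i \<Rightarrow> 'k \<Rightarrow> complex" where
  "gscale c x = (\<lambda>i. tscale c (x i))"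

text \<open>Homogeneous pure tensors, with the arrows serving as degrees.\<close>

definition pure2 ::
  "(complex \<Rightarrow> 'v \<Rightarrow> 'v::ab_group_add) \<Rightarrow> 'm \<Rightarrow> 'm \<Rightarrow> 'v \<Rightarrow> 'v \<Rightarrow> ('m, 'v) gtens2" where
  "pure2 sc \<alpha>\<^sub>1 \<alpha>\<^sub>2 u v = (\<lambda>p. if p = (\<alpha>\<^sub>1, \<alpha>\<^sub>2) then tensor2 sc u v else 0)"

definition pure3 ::
  "(complex \<Rightarrow> 'v \<Rightarrow> 'v::ab_group_add) \<Rightarrow> 'm \<Rightarrow> 'm \<Rightarrow> 'm \<Rightarrow> 'v \<Rightarrow> 'v \<Rightarrow> 'v \<Rightarrow> ('m, 'v) gtens3" where
  "pure3 sc \<alpha>\<^sub>1 \<alpha>\<^sub>2 \<alpha>\<^sub>3 u v w = (\<lambda>p. if p = (\<alpha>\<^sub>1, \<alpha>\<^sub>2, \<alpha>\<^sub>3) then tensor3 sc u v w else 0)"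

text \<open>
  \<open>tensor_vec sc x \<alpha> w\<close> is \<open>x \<otimes> w\<close> and \<open>vec_tensor sc \<alpha> u x\<close> is \<open>u \<otimes> x\<close>, for \<open>x\<close> in some
  degree of \<open>V \<otimes> V\<close> and a vector \<open>w\<close>, respectively \<open>u\<close>, of \<open>V \<alpha>\<close>.
\<close>

definition tensor_vec ::
  "(complex \<Rightarrow> 'v \<Rightarrow> 'v::ab_group_add) \<Rightarrow> ('m, 'v) gtens2 \<Rightarrow> 'm \<Rightarrow> 'v \<Rightarrow> ('m, 'v) gtens3" where
  "tensor_vec sc x \<alpha> w = (\<lambda>(\<beta>\<^sub>1, \<beta>\<^sub>2, \<beta>\<^sub>3) T.
     if \<beta>\<^sub>3 = \<alpha> \<and> trilinear_form sc T then x (\<beta>\<^sub>1, \<beta>\<^sub>2) (\<lambda>u v. T u v w) else 0)"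

definition vec_tensor ::
  "(complex \<Rightarrow> 'v \<Rightarrow> 'v::ab_group_add) \<Rightarrow> 'm \<Rightarrow> 'v \<Rightarrow> ('m, 'v) gtens2 \<Rightarrow> ('m, 'v) gtens3" where
  "vec_tensor sc \<alpha> u x = (\<lambda>(\<beta>\<^sub>1, \<beta>\<^sub>2, \<beta>\<^sub>3) T.
     if \<beta>\<^sub>1 = \<alpha> \<and> trilinear_form sc T then x (\<beta>\<^sub>2, \<beta>\<^sub>3) (\<lambda>v w. T u v w) else 0)"

lemma tensor_vec_pure2: "tensor_vec sc (pure2 sc \<alpha>\<^sub>1 \<alpha>\<^sub>2 u v) \<alpha>\<^sub>3 w = pure3 sc \<alpha>\<^sub>1 \<alpha>\<^sub>2 \<alpha>\<^sub>3 u v w"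
  by (auto simp: fun_eq_iff tensor_vec_def pure2_def pure3_def tensor2_def tensor3_def
      bilinear_form_def trilinear_form_def)

lemma vec_tensor_pure2: "vec_tensor sc \<alpha>\<^sub>1 u (pure2 sc \<alpha>\<^sub>2 \<alpha>\<^sub>3 v w) = pure3 sc \<alpha>\<^sub>1 \<alpha>\<^sub>2 \<alpha>\<^sub>3 u v w"
  by (auto simp: fun_eq_iff vec_tensor_def pure2_def pure3_def tensor2_def tensor3_def
      bilinear_form_def trilinear_form_def)

section \<open>Operators on source fibers\<close>

text \<open>
  For \<open>W :: 'm \<Rightarrow> (\<dots>) set\<close> a graded space, an element of the direct sum over \<open>\<gamma>\<close> in
  \<open>source_fiber \<pi> a\<close> of \<open>End (W \<gamma>)\<close> is a family \<open>X\<close> whose component at \<open>\<gamma>\<close> is \<open>X \<gamma>\<close>. Only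
  the values \<open>X \<gamma> x\<close> with \<open>\<gamma> \<in> source_fiber \<pi> a\<close> and \<open>x \<in> W \<gamma>\<close> are meaningful, so equality
  of operators is \<open>fiber_eq\<close>.
\<close>

type_synonym ('m, 'x) fiber_op = "'m \<Rightarrow> 'x \<Rightarrow> 'x"

definition endo_on ::
  "('i \<Rightarrow> 'k \<Rightarrow> complex) set \<Rightarrow> (('i \<Rightarrow> 'k \<Rightarrow> complex) \<Rightarrow> ('i \<Rightarrow> 'k \<Rightarrow> complex)) \<Rightarrow> bool" where
  "endo_on A F \<longleftrightarrow>
     (\<forall>x\<in>A. F x \<in> A) \<and> (\<forall>x\<in>A. \<forall>y\<in>A. F (x + y) = F x + F y) \<and>
     (\<forall>c. \<forall>x\<in>A. F (gscale c x) = gscale c (F x))"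

definition fiber_End ::
  "('o, 'm) groupoid_data \<Rightarrow> ('m \<Rightarrow> ('i \<Rightarrow> 'k \<Rightarrow> complex) set) \<Rightarrow> 'o \<Rightarrow>
   ('m, 'i \<Rightarrow> 'k \<Rightarrow> complex) fiber_op set" where
  "fiber_End \<pi> W a =
     {X. (\<forall>\<gamma>\<in>source_fiber \<pi> a. endo_on (W \<gamma>) (X \<gamma>)) \<and>
         finite {\<gamma> \<in> source_fiber \<pi> a. \<exists>x\<in>W \<gamma>. X \<gamma> x \<noteq> 0}}"

definition fiber_eq ::
  "('o, 'm) groupoid_data \<Rightarrow> ('m \<Rightarrow> 'x set) \<Rightarrow> 'o \<Rightarrow> ('m, 'x) fiber_op \<Rightarrow> ('m, 'x) fiber_op \<Rightarrow> bool" where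
  "fiber_eq \<pi> W a X Y \<longleftrightarrow> (\<forall>\<gamma>\<in>source_fiber \<pi> a. \<forall>x\<in>W \<gamma>. X \<gamma> x = Y \<gamma> x)"

definition fiber_comp ::
  "('m, 'x) fiber_op \<Rightarrow> ('m, 'x) fiber_op \<Rightarrow> ('m, 'x) fiber_op" (infixl "\<odot>" 70) where
  "X \<odot> Y = (\<lambda>\<gamma>. X \<gamma> \<circ> Y \<gamma>)"

definition fiber_id :: "('m, 'x) fiber_op" where
  "fiber_id = (\<lambda>\<gamma> x. x)"

definition fiber_scale ::
  "complex \<Rightarrow> ('m, 'i \<Rightarrow> 'k \<Rightarrow> complex) fiber_op \<Rightarrow> ('m, 'i \<Rightarrow> 'k \<Rightarrow> complex) fiber_op" where
  "fiber_scale c X = (\<lambda>\<gamma> x. gscale c (X \<gamma> x))"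

definition fiber_invertible ::
  "('o, 'm) groupoid_data \<Rightarrow> ('m \<Rightarrow> ('i \<Rightarrow> 'k \<Rightarrow> complex) set) \<Rightarrow> 'o \<Rightarrow>
   ('m, 'i \<Rightarrow> 'k \<Rightarrow> complex) fiber_op \<Rightarrow> bool" where
  "fiber_invertible \<pi> W a X \<longleftrightarrow>
     X \<in> fiber_End \<pi> W a \<and>
     (\<exists>Y\<in>fiber_End \<pi> W a. fiber_eq \<pi> W a (X \<odot> Y) fiber_id \<and> fiber_eq \<pi> W a (Y \<odot> X) fiber_id)"

definition fiber_inv :: "('m \<Rightarrow> 'x set) \<Rightarrow> ('m, 'x) fiber_op \<Rightarrow> ('m, 'x) fiber_op" where
  "fiber_inv W X = (\<lambda>\<gamma>. inv_into (W \<gamma>) (X \<gamma>))"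

text \<open>
  \<open>op12 \<pi> sc V X a\<close> is \<open>X\<^sup>(\<^sup>1\<^sup>2\<^sup>)(a)\<close> and \<open>op23 \<pi> sc V X a\<close> is \<open>X\<^sup>(\<^sup>2\<^sup>3\<^sup>)(a h\<^sup>(\<^sup>1\<^sup>))\<close>: the unique linear
  operators given by the stated formulas on pure tensors. The clause that they vanish off the
  source fiber only fixes meaningless values, so that the description is unique.
\<close>

definition op12 ::
  "('o, 'm) groupoid_data \<Rightarrow> (complex \<Rightarrow> 'v \<Rightarrow> 'v::ab_group_add) \<Rightarrow> ('m \<Rightarrow> 'v set) \<Rightarrow>
   ('o \<Rightarrow> ('m, ('m, 'v) gtens2) fiber_op) \<Rightarrow> 'o \<Rightarrow> ('m, ('m, 'v) gtens3) fiber_op" where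
  "op12 \<pi> sc V X a = (THE F.
     F \<in> fiber_End \<pi> (graded_tensor3 \<pi> sc V V V) a \<and>
     (\<forall>\<gamma> x. \<gamma> \<notin> source_fiber \<pi> a \<or> x \<notin> graded_tensor3 \<pi> sc V V V \<gamma> \<longrightarrow> F \<gamma> x = 0) \<and>
     (\<forall>\<alpha>\<^sub>1 \<alpha>\<^sub>2 \<alpha>\<^sub>3. \<forall>u\<in>V \<alpha>\<^sub>1. \<forall>v\<in>V \<alpha>\<^sub>2. \<forall>w\<in>V \<alpha>\<^sub>3. composable3 \<pi> \<alpha>\<^sub>1 \<alpha>\<^sub>2 \<alpha>\<^sub>3 \<and> src \<pi> \<alpha>\<^sub>1 = a \<longrightarrow>
        F (cmp \<pi> \<alpha>\<^sub>3 (cmp \<pi> \<alpha>\<^sub>2 \<alpha>\<^sub>1)) (pure3 sc \<alpha>\<^sub>1 \<alpha>\<^sub>2 \<alpha>\<^sub>3 u v w) =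
          tensor_vec sc (X a (cmp \<pi> \<alpha>\<^sub>2 \<alpha>\<^sub>1) (pure2 sc \<alpha>\<^sub>1 \<alpha>\<^sub>2 u v)) \<alpha>\<^sub>3 w))"

definition op23 ::
  "('o, 'm) groupoid_data \<Rightarrow> (complex \<Rightarrow> 'v \<Rightarrow> 'v::ab_group_add) \<Rightarrow> ('m \<Rightarrow> 'v set) \<Rightarrow>
   ('o \<Rightarrow> ('m, ('m, 'v) gtens2) fiber_op) \<Rightarrow> 'o \<Rightarrow> ('m, ('m, 'v) gtens3) fiber_op" where
  "op23 \<pi> sc V X a = (THE F.
     F \<in> fiber_End \<pi> (graded_tensor3 \<pi> sc V V V) a \<and>
     (\<forall>\<gamma> x. \<gamma> \<notin> source_fiber \<pi> a \<or> x \<notin> graded_tensor3 \<pi> sc V V V \<gamma> \<longrightarrow> F \<gamma> x = 0) \<and>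
     (\<forall>\<alpha>\<^sub>1 \<alpha>\<^sub>2 \<alpha>\<^sub>3. \<forall>u\<in>V \<alpha>\<^sub>1. \<forall>v\<in>V \<alpha>\<^sub>2. \<forall>w\<in>V \<alpha>\<^sub>3. composable3 \<pi> \<alpha>\<^sub>1 \<alpha>\<^sub>2 \<alpha>\<^sub>3 \<and> src \<pi> \<alpha>\<^sub>1 = a \<longrightarrow>
        F (cmp \<pi> \<alpha>\<^sub>3 (cmp \<pi> \<alpha>\<^sub>2 \<alpha>\<^sub>1)) (pure3 sc \<alpha>\<^sub>1 \<alpha>\<^sub>2 \<alpha>\<^sub>3 u v w) =
          vec_tensor sc \<alpha>\<^sub>1 u (X (tgt \<pi> \<alpha>\<^sub>1) (cmp \<pi> \<alpha>\<^sub>3 \<alpha>\<^sub>2) (pure2 sc \<alpha>\<^sub>2 \<alpha>\<^sub>3 v w))))"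

definition R_check ::
  "('m \<Rightarrow> ('i \<Rightarrow> 'k \<Rightarrow> complex) set) \<Rightarrow> ('o \<Rightarrow> ('m, 'i \<Rightarrow> 'k \<Rightarrow> complex) fiber_op) \<Rightarrow>
   complex \<Rightarrow> 'o \<Rightarrow> ('m, 'i \<Rightarrow> 'k \<Rightarrow> complex) fiber_op" where
  "R_check W \<sigma> z a = fiber_scale (exp z) (\<sigma> a) + fiber_scale (exp (- z)) (fiber_inv W (\<sigma> a))"

end

theory Submission
  imports Defs
begin

text \<open>
  The relation \<open>\<sigma> + \<sigma>\<^sup>-\<^sup>1 = f\<close> is a Hecke relation \<open>\<sigma>\<^sup>2 = f \<sigma> - 1\<close>, and it makes the Baxterized operator
  affine in \<open>\<sigma>\<close>: \<open>R(z) = p(z) \<sigma> + q(z)\<close> with \<open>p(z) = exp z - exp (- z)\<close> and \<open>q(z) = exp (- z) f\<close>.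
  Let \<open>A\<close> and \<open>B\<close> be \<open>\<sigma>\<close> acting on the first two and on the last two factors. Both satisfy the
  same Hecke relation: \<open>B\<close> applies \<open>\<sigma>\<close> at the target of the first arrow, where \<open>f\<close> has the same
  value as at its source. The braid relation \<open>ABA = BAB\<close> and the two Hecke relations then
  reduce the Yang--Baxter equation to one identity between exponentials (\<open>baxterization\<close>,
  \<open>exp_baxter_identity\<close>).

  Most of the work is to pass from \<open>V \<otimes> V\<close> to \<open>V \<otimes> V \<otimes> V\<close>. The operators on two of the three factors
  are given by a definite description, which says nothing until existence and uniqueness are
  established. Both follow from the universal property of the threefold tensor product
  (\<open>ex1_fiber_End\<close>): every family of trilinear maps on the homogeneous components extends
  uniquely to an operator on the source fiber. Uniqueness also shows that passing to the threefold
  product respects affine combinations with scalar operators (\<open>op12_affine\<close>, \<open>op23_affine\<close>) and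
  quadratic relations (\<open>op12_quadratic\<close>, \<open>op23_quadratic\<close>), because each such identity can be
  tested on pure tensors.
\<close>

section \<open>Linear maps between spaces of finitely supported families\<close>

global_interpretation tscale: vector_space "tscale :: complex \<Rightarrow> ('k \<Rightarrow> complex) \<Rightarrow> _"
  by unfold_locales (auto simp: tscale_def fun_eq_iff algebra_simps)

global_interpretation gscale: vector_space "gscale :: complex \<Rightarrow> ('i \<Rightarrow> 'k \<Rightarrow> complex) \<Rightarrow> _"
  by unfold_locales (auto simp: gscale_def tscale_def fun_eq_iff algebra_simps)

lemma gscale_apply: "gscale c x i k = c * x i k"
  by (simp add: gscale_def tscale_def)

text \<open>
  Vectors here are functions, but linear algebra must treat them as opaque: pointwise rewriting
  is switched off by default and invoked through \<open>pointwise\<close> only where values are compared.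
\<close>
declare plus_fun_apply [simp del] zero_fun_apply [simp del]

lemmas pointwise = fun_eq_iff gscale_apply plus_fun_apply zero_fun_apply

lemma gscale_minus_swap:
  assumes "y = x + gscale (- 1) t"
  shows "t = x + gscale (- 1) y"
  unfolding assms by (simp add: pointwise)

definition linear_map_on ::
  "('c \<Rightarrow> 'a \<Rightarrow> 'a::ab_group_add) \<Rightarrow> ('c \<Rightarrow> 'b \<Rightarrow> 'b::ab_group_add) \<Rightarrow> 'a set \<Rightarrow> ('a \<Rightarrow> 'b) \<Rightarrow> bool" where
  "linear_map_on s\<^sub>1 s\<^sub>2 A F \<longleftrightarrow>
     (\<forall>x\<in>A. \<forall>y\<in>A. F (x + y) = F x + F y) \<and> (\<forall>c. \<forall>x\<in>A. F (s\<^sub>1 c x) = s\<^sub>2 c (F x))"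

lemma linear_map_on_0:
  assumes "linear_map_on s\<^sub>1 s\<^sub>2 A F" "0 \<in> A"
  shows "F 0 = 0"
proof -
  have "F (0 + 0) = F 0 + F 0"
    using assms unfolding linear_map_on_def by blast
  then show ?thesis by simp
qed

lemma endo_on_iff: "endo_on A F \<longleftrightarrow> F ` A \<subseteq> A \<and> linear_map_on gscale gscale A F"
  by (auto simp: endo_on_def linear_map_on_def)

lemma linear_map_on_add:
  fixes F G :: "'a::ab_group_add \<Rightarrow> 'i \<Rightarrow> 'k \<Rightarrow> complex"
  assumes "linear_map_on s gscale A F" "linear_map_on s gscale A G"
  shows "linear_map_on s gscale A (\<lambda>x. F x + G x)"
  unfolding linear_map_on_def
proof (intro conjI ballI allI)
  fix x y assume "x \<in> A" "y \<in> A"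
  then have "F (x + y) = F x + F y" "G (x + y) = G x + G y"
    using assms unfolding linear_map_on_def by blast+
  then show "F (x + y) + G (x + y) = F x + G x + (F y + G y)"
    by (simp only: add.assoc add.left_commute)
next
  fix c x assume "x \<in> A"
  then have "F (s c x) = gscale c (F x)" "G (s c x) = gscale c (G x)"
    using assms unfolding linear_map_on_def by blast+
  then show "F (s c x) + G (s c x) = gscale c (F x + G x)"
    by (simp only: gscale.scale_right_distrib)
qed

lemma linear_map_on_scale:
  fixes F :: "'a::ab_group_add \<Rightarrow> 'i \<Rightarrow> 'k \<Rightarrow> complex"
  assumes "linear_map_on s gscale A F"
  shows "linear_map_on s gscale A (\<lambda>x. gscale d (F x))"
  unfolding linear_map_on_def
proof (intro conjI ballI allI)
  fix x y assume "x \<in> A" "y \<in> A"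
  then have "F (x + y) = F x + F y"
    using assms unfolding linear_map_on_def by blast
  then show "gscale d (F (x + y)) = gscale d (F x) + gscale d (F y)"
    by (simp only: gscale.scale_right_distrib)
next
  fix c x assume "x \<in> A"
  then have "F (s c x) = gscale c (F x)"
    using assms unfolding linear_map_on_def by blast
  then show "gscale d (F (s c x)) = gscale c (gscale d (F x))"
    by (simp only: gscale.scale_scale mult.commute)
qed

lemma linear_map_on_affine:
  assumes "linear_map_on gscale gscale A F"
  shows "linear_map_on gscale gscale A (\<lambda>x. gscale p (F x) + gscale q x)"
proof -
  have "linear_map_on gscale gscale A (\<lambda>x. x)" by (simp add: linear_map_on_def)
  then show ?thesis by (intro linear_map_on_add linear_map_on_scale assms)
qed

lemma endo_on_affine:
  assumes "gscale.subspace A" "endo_on A F"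
  shows "endo_on A (\<lambda>x. gscale p (F x) + gscale q x)"
  using assms
  by (auto simp: endo_on_iff linear_map_on_affine intro!: gscale.subspace_add gscale.subspace_scale)

definition trilinear_on ::
  "(complex \<Rightarrow> 'v \<Rightarrow> 'v::ab_group_add) \<Rightarrow> 'v set \<Rightarrow> 'v set \<Rightarrow> 'v set \<Rightarrow>
   ('v \<Rightarrow> 'v \<Rightarrow> 'v \<Rightarrow> 'i \<Rightarrow> 'k \<Rightarrow> complex) \<Rightarrow> bool" where
  "trilinear_on sc A B C g \<longleftrightarrow>
     (\<forall>v\<in>B. \<forall>w\<in>C. linear_map_on sc gscale A (\<lambda>u. g u v w)) \<and>
     (\<forall>u\<in>A. \<forall>w\<in>C. linear_map_on sc gscale B (\<lambda>v. g u v w)) \<and>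
     (\<forall>u\<in>A. \<forall>v\<in>B. linear_map_on sc gscale C (\<lambda>w. g u v w))"

lemma linear_form_iff:
  assumes "vector_space sc"
  shows "Vector_Spaces.linear sc (*) (g :: _ \<Rightarrow> complex) \<longleftrightarrow>
    (\<forall>x y. g (x + y) = g x + g y) \<and> (\<forall>c x. g (sc c x) = c * g x)"
proof -
  interpret vector_space sc by fact
  have "vector_space ((*) :: complex \<Rightarrow> complex \<Rightarrow> complex)"
    by unfold_locales (auto simp: algebra_simps)
  then show ?thesis
    using assms by (auto simp: Vector_Spaces.linear_iff)
qed

text \<open>
  A finitely supported family is the sum of its entries, each placed at its own index; hence
  the graded tensor products are spanned by the homogeneous pure tensors.
\<close>
lemma finite_support_in_span:
  fixes x :: "'i \<Rightarrow> 'k \<Rightarrow> complex"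
  assumes fin: "finite {p. x p \<noteq> 0}"
    and x: "\<And>p. x p \<in> (if P p then module.span tscale (T p) else {0})"
  shows "x \<in> module.span gscale {(\<lambda>q. if q = p then t else 0) | p t. P p \<and> t \<in> T p}"
    (is "x \<in> module.span gscale ?S")
proof -
  define single where "single p t = (\<lambda>q. if q = p then t else (0 :: 'k \<Rightarrow> complex))" for p :: 'i and t
  have single: "single p t \<in> gscale.span ?S" if "P p" "t \<in> tscale.span (T p)" for p t
    using that(2)
  proof (rule tscale.span_induct)
    have 0: "single p 0 = 0" and add: "single p (s + t) = single p s + single p t"
      and scale: "single p (tscale c s) = gscale c (single p s)" for s t c
      by (auto simp: single_def pointwise tscale_def)
    show "tscale.subspace {t. single p t \<in> gscale.span ?S}"
    proof (rule tscale.subspaceI)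
      show "0 \<in> {t. single p t \<in> gscale.span ?S}"
        unfolding mem_Collect_eq 0 by (rule gscale.span_zero)
      show "s + t \<in> {t. single p t \<in> gscale.span ?S}"
        if "s \<in> {t. single p t \<in> gscale.span ?S}" "t \<in> {t. single p t \<in> gscale.span ?S}" for s t
        using that unfolding mem_Collect_eq add by (rule gscale.span_add)
      show "tscale c s \<in> {t. single p t \<in> gscale.span ?S}"
        if "s \<in> {t. single p t \<in> gscale.span ?S}" for c s
        using that unfolding mem_Collect_eq scale by (rule gscale.span_scale)
    qed
  next
    fix t assume "t \<in> T p"
    then show "single p t \<in> gscale.span ?S"
      using that(1) by (intro gscale.span_base) (auto simp: single_def)
  qed
  have "y \<in> gscale.span ?S" if "finite A" "{p. y p \<noteq> 0} \<subseteq> A" "\<forall>p\<in>A. y p = x p \<or> y p = 0" for A y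
    using that
  proof (induction A arbitrary: y rule: finite_induct)
    case empty
    then have "y = 0" by (auto simp: pointwise)
    show ?case unfolding \<open>y = 0\<close> by (rule gscale.span_zero)
  next
    case (insert p A)
    define z where "z = (\<lambda>q. if q = p then 0 else y q)"
    have "z \<in> gscale.span ?S"
      using insert.prems insert.hyps by (intro insert.IH) (auto simp: z_def)
    moreover have "single p (y p) \<in> gscale.span ?S"
    proof (cases "P p")
      case True
      moreover have "y p \<in> tscale.span (T p)"
        using insert.prems(2) x[of p] True tscale.span_zero[of "T p"] by (metis insertI1)
      ultimately show ?thesis by (rule single)
    next
      case False
      then have "y p = 0" using x[of p] insert.prems(2) by auto
      then have "single p (y p) = 0" by (auto simp: single_def pointwise)
      show ?thesis unfolding \<open>single p (y p) = 0\<close> by (rule gscale.span_zero)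
    qed
    ultimately have "z + single p (y p) \<in> gscale.span ?S"
      by (rule gscale.span_add)
    moreover have "z + single p (y p) = y"
      by (auto simp: z_def single_def pointwise)
    ultimately show ?case by argo
  qed
  from this[OF fin] show ?thesis by auto
qed

section \<open>Graded tensor powers\<close>

locale graded_space = groupoid \<pi>
  for \<pi> :: "('o, 'm) groupoid_data" +
  fixes sc :: "complex \<Rightarrow> 'v \<Rightarrow> 'v::ab_group_add"
    and V :: "'m \<Rightarrow> 'v set"
  assumes finite_type: "graded_finite_type \<pi> sc V"
begin

abbreviation "VV \<equiv> graded_tensor2 \<pi> sc V V"
abbreviation "VVV \<equiv> graded_tensor3 \<pi> sc V V V"

sublocale sc: vector_space sc
  using finite_type by (simp add: graded_finite_type_def)

lemmas form_iff = linear_form_iff[OF sc.vector_space_axioms]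

lemma subspace_V: "\<alpha> \<in> Arr \<pi> \<Longrightarrow> sc.subspace (V \<alpha>)"
  using finite_type by (simp add: graded_finite_type_def)

lemma source_fiber_Ob: "\<gamma> \<in> source_fiber \<pi> a \<Longrightarrow> a \<in> Ob \<pi>"
  by (auto simp: source_fiber_def src_in)

lemma composable3_composite:
  assumes "composable3 \<pi> \<alpha>\<^sub>1 \<alpha>\<^sub>2 \<alpha>\<^sub>3"
  shows "cmp \<pi> \<alpha>\<^sub>2 \<alpha>\<^sub>1 \<in> source_fiber \<pi> (src \<pi> \<alpha>\<^sub>1)"
    and "cmp \<pi> \<alpha>\<^sub>3 \<alpha>\<^sub>2 \<in> source_fiber \<pi> (tgt \<pi> \<alpha>\<^sub>1)"
    and "cmp \<pi> \<alpha>\<^sub>3 (cmp \<pi> \<alpha>\<^sub>2 \<alpha>\<^sub>1) \<in> source_fiber \<pi> (src \<pi> \<alpha>\<^sub>1)"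
    and "tgt \<pi> (cmp \<pi> \<alpha>\<^sub>2 \<alpha>\<^sub>1) = src \<pi> \<alpha>\<^sub>3"
    and "cmp \<pi> \<alpha>\<^sub>3 (cmp \<pi> \<alpha>\<^sub>2 \<alpha>\<^sub>1) = cmp \<pi> (cmp \<pi> \<alpha>\<^sub>3 \<alpha>\<^sub>2) \<alpha>\<^sub>1"
  using assms
  by (auto simp: composable3_def composable2_def source_fiber_def cmp_in src_cmp tgt_cmp cmp_assoc)

lemma subspace_VV: "gscale.subspace (VV \<gamma>)"
proof -
  define D where "D = (\<lambda>(\<alpha>, \<beta>). if composable2 \<pi> \<alpha> \<beta> \<and> cmp \<pi> \<beta> \<alpha> = \<gamma> then tensor_space2 sc (V \<alpha>) (V \<beta>) else {0})"
  have D: "tscale.subspace (D p)" for p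
    by (cases p) (simp add: D_def tensor_space2_def tscale.subspace_span tscale.subspace_single_0)
  have mem: "x \<in> VV \<gamma> \<longleftrightarrow> finite {p. x p \<noteq> 0} \<and> (\<forall>p. x p \<in> D p)" for x
    by (simp add: graded_tensor2_def D_def)
  show ?thesis
    unfolding gscale.subspace_def mem
  proof (intro conjI ballI allI)
    fix x y p c assume "x \<in> VV \<gamma>" "y \<in> VV \<gamma>"
    then have x: "finite {p. x p \<noteq> 0}" "x p \<in> D p" and y: "finite {p. y p \<noteq> 0}" "y p \<in> D p"
      unfolding mem by blast+
    show "finite {p. (x + y) p \<noteq> 0}"
      by (rule finite_subset[OF _ finite_UnI[OF x(1) y(1)]]) (auto simp: plus_fun_apply)
    show "finite {p. gscale c x p \<noteq> 0}"
      by (rule finite_subset[OF _ x(1)]) (auto simp: gscale_def)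
    show "(x + y) p \<in> D p" "gscale c x p \<in> D p"
      using x(2) y(2) by (auto simp: gscale_def plus_fun_apply tscale.subspace_add[OF D] tscale.subspace_scale[OF D])
  qed (auto simp: zero_fun_apply tscale.subspace_0[OF D])
qed

lemma subspace_VVV: "gscale.subspace (VVV \<gamma>)"
proof -
  define D where "D = (\<lambda>(\<alpha>\<^sub>1, \<alpha>\<^sub>2, \<alpha>\<^sub>3). if composable3 \<pi> \<alpha>\<^sub>1 \<alpha>\<^sub>2 \<alpha>\<^sub>3 \<and> cmp \<pi> \<alpha>\<^sub>3 (cmp \<pi> \<alpha>\<^sub>2 \<alpha>\<^sub>1) = \<gamma> then tensor_space3 sc (V \<alpha>\<^sub>1) (V \<alpha>\<^sub>2) (V \<alpha>\<^sub>3) else {0})"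
  have D: "tscale.subspace (D p)" for p
    by (cases p) (simp add: D_def tensor_space3_def tscale.subspace_span tscale.subspace_single_0)
  have mem: "x \<in> VVV \<gamma> \<longleftrightarrow> finite {p. x p \<noteq> 0} \<and> (\<forall>p. x p \<in> D p)" for x
    by (simp add: graded_tensor3_def D_def)
  show ?thesis
    unfolding gscale.subspace_def mem
  proof (intro conjI ballI allI)
    fix x y p c assume "x \<in> VVV \<gamma>" "y \<in> VVV \<gamma>"
    then have x: "finite {p. x p \<noteq> 0}" "x p \<in> D p" and y: "finite {p. y p \<noteq> 0}" "y p \<in> D p"
      unfolding mem by blast+
    show "finite {p. (x + y) p \<noteq> 0}"
      by (rule finite_subset[OF _ finite_UnI[OF x(1) y(1)]]) (auto simp: plus_fun_apply)
    show "finite {p. gscale c x p \<noteq> 0}"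
      by (rule finite_subset[OF _ x(1)]) (auto simp: gscale_def)
    show "(x + y) p \<in> D p" "gscale c x p \<in> D p"
      using x(2) y(2) by (auto simp: gscale_def plus_fun_apply tscale.subspace_add[OF D] tscale.subspace_scale[OF D])
  qed (auto simp: zero_fun_apply tscale.subspace_0[OF D])
qed

lemmas VV_closed = gscale.subspace_0[OF subspace_VV] gscale.subspace_add[OF subspace_VV]
  gscale.subspace_scale[OF subspace_VV]
lemmas VVV_closed = gscale.subspace_0[OF subspace_VVV] gscale.subspace_add[OF subspace_VVV]
  gscale.subspace_scale[OF subspace_VVV]

lemma pure2_in_VV:
  assumes "composable2 \<pi> \<alpha>\<^sub>1 \<alpha>\<^sub>2" "u \<in> V \<alpha>\<^sub>1" "v \<in> V \<alpha>\<^sub>2"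
  shows "pure2 sc \<alpha>\<^sub>1 \<alpha>\<^sub>2 u v \<in> VV (cmp \<pi> \<alpha>\<^sub>2 \<alpha>\<^sub>1)"
proof -
  have "finite {p. pure2 sc \<alpha>\<^sub>1 \<alpha>\<^sub>2 u v p \<noteq> 0}"
    by (rule finite_subset[of _ "{(\<alpha>\<^sub>1, \<alpha>\<^sub>2)}"]) (auto simp: pure2_def)
  moreover have "tensor2 sc u v \<in> tensor_space2 sc (V \<alpha>\<^sub>1) (V \<alpha>\<^sub>2)"
    unfolding tensor_space2_def by (rule tscale.span_base) (use assms in blast)
  ultimately show ?thesis
    using assms(1) by (auto simp: graded_tensor2_def pure2_def tensor_space2_def tscale.span_zero)
qed

lemma pure3_in_VVV:
  assumes "composable3 \<pi> \<alpha>\<^sub>1 \<alpha>\<^sub>2 \<alpha>\<^sub>3" "u \<in> V \<alpha>\<^sub>1" "v \<in> V \<alpha>\<^sub>2" "w \<in> V \<alpha>\<^sub>3"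
  shows "pure3 sc \<alpha>\<^sub>1 \<alpha>\<^sub>2 \<alpha>\<^sub>3 u v w \<in> VVV (cmp \<pi> \<alpha>\<^sub>3 (cmp \<pi> \<alpha>\<^sub>2 \<alpha>\<^sub>1))"
proof -
  have "finite {p. pure3 sc \<alpha>\<^sub>1 \<alpha>\<^sub>2 \<alpha>\<^sub>3 u v w p \<noteq> 0}"
    by (rule finite_subset[of _ "{(\<alpha>\<^sub>1, \<alpha>\<^sub>2, \<alpha>\<^sub>3)}"]) (auto simp: pure3_def)
  moreover have "tensor3 sc u v w \<in> tensor_space3 sc (V \<alpha>\<^sub>1) (V \<alpha>\<^sub>2) (V \<alpha>\<^sub>3)"
    unfolding tensor_space3_def by (rule tscale.span_base) (use assms in blast)
  ultimately show ?thesis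
    using assms(1) by (auto simp: graded_tensor3_def pure3_def tensor_space3_def tscale.span_zero)
qed

text \<open>Membership in \<open>VV \<gamma>\<close> is available in the closure steps because the operators are linear only there.\<close>
lemma VV_induct [consumes 1, case_names zero add scale pure]:
  assumes x: "x \<in> VV \<gamma>"
    and zero: "Q 0"
    and add: "\<And>x y. \<lbrakk>x \<in> VV \<gamma>; y \<in> VV \<gamma>; Q x; Q y\<rbrakk> \<Longrightarrow> Q (x + y)"
    and scale: "\<And>c x. \<lbrakk>x \<in> VV \<gamma>; Q x\<rbrakk> \<Longrightarrow> Q (gscale c x)"
    and pure: "\<And>\<alpha>\<^sub>1 \<alpha>\<^sub>2 u v. \<lbrakk>composable2 \<pi> \<alpha>\<^sub>1 \<alpha>\<^sub>2; cmp \<pi> \<alpha>\<^sub>2 \<alpha>\<^sub>1 = \<gamma>; u \<in> V \<alpha>\<^sub>1; v \<in> V \<alpha>\<^sub>2\<rbrakk>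
      \<Longrightarrow> Q (pure2 sc \<alpha>\<^sub>1 \<alpha>\<^sub>2 u v)"
  shows "Q x"
proof -
  let ?P = "\<lambda>(\<alpha>\<^sub>1, \<alpha>\<^sub>2). composable2 \<pi> \<alpha>\<^sub>1 \<alpha>\<^sub>2 \<and> cmp \<pi> \<alpha>\<^sub>2 \<alpha>\<^sub>1 = \<gamma>"
  let ?T = "\<lambda>(\<alpha>\<^sub>1, \<alpha>\<^sub>2). {tensor2 sc u v | u v. u \<in> V \<alpha>\<^sub>1 \<and> v \<in> V \<alpha>\<^sub>2}"
  have "x \<in> gscale.span {(\<lambda>q. if q = p then t else 0) | p t. ?P p \<and> t \<in> ?T p}"
  proof (rule finite_support_in_span)
    show "finite {p. x p \<noteq> 0}"
      using x by (simp add: graded_tensor2_def)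
    fix p :: "'m \<times> 'm"
    obtain \<alpha>\<^sub>1 \<alpha>\<^sub>2 where p: "p = (\<alpha>\<^sub>1, \<alpha>\<^sub>2)"
      by (cases p)
    have "x (\<alpha>\<^sub>1, \<alpha>\<^sub>2) \<in> (if ?P (\<alpha>\<^sub>1, \<alpha>\<^sub>2) then tensor_space2 sc (V \<alpha>\<^sub>1) (V \<alpha>\<^sub>2) else {0})"
      using x by (simp add: graded_tensor2_def)
    then show "x p \<in> (if ?P p then tscale.span (?T p) else {0})"
      by (simp only: p tensor_space2_def prod.case)
  qed
  then have "x \<in> VV \<gamma> \<and> Q x"
  proof (rule gscale.span_induct)
    show "gscale.subspace {x. x \<in> VV \<gamma> \<and> Q x}"
      by (rule gscale.subspaceI) (auto simp: VV_closed zero add scale)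
  next
    fix y assume "y \<in> {(\<lambda>q. if q = p then t else 0) | p t. ?P p \<and> t \<in> ?T p}"
    then obtain \<alpha>\<^sub>1 \<alpha>\<^sub>2 u v where "composable2 \<pi> \<alpha>\<^sub>1 \<alpha>\<^sub>2" "cmp \<pi> \<alpha>\<^sub>2 \<alpha>\<^sub>1 = \<gamma>" "u \<in> V \<alpha>\<^sub>1" "v \<in> V \<alpha>\<^sub>2"
      "y = pure2 sc \<alpha>\<^sub>1 \<alpha>\<^sub>2 u v"
      by (auto simp: pure2_def)
    then show "y \<in> VV \<gamma> \<and> Q y"
      using pure2_in_VV pure by metis
  qed
  then show ?thesis ..
qed

lemma VVV_induct [consumes 1, case_names zero add scale pure]:
  assumes x: "x \<in> VVV \<gamma>"
    and zero: "Q 0"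
    and add: "\<And>x y. \<lbrakk>x \<in> VVV \<gamma>; y \<in> VVV \<gamma>; Q x; Q y\<rbrakk> \<Longrightarrow> Q (x + y)"
    and scale: "\<And>c x. \<lbrakk>x \<in> VVV \<gamma>; Q x\<rbrakk> \<Longrightarrow> Q (gscale c x)"
    and pure: "\<And>\<alpha>\<^sub>1 \<alpha>\<^sub>2 \<alpha>\<^sub>3 u v w. \<lbrakk>composable3 \<pi> \<alpha>\<^sub>1 \<alpha>\<^sub>2 \<alpha>\<^sub>3; cmp \<pi> \<alpha>\<^sub>3 (cmp \<pi> \<alpha>\<^sub>2 \<alpha>\<^sub>1) = \<gamma>;
        u \<in> V \<alpha>\<^sub>1; v \<in> V \<alpha>\<^sub>2; w \<in> V \<alpha>\<^sub>3\<rbrakk> \<Longrightarrow> Q (pure3 sc \<alpha>\<^sub>1 \<alpha>\<^sub>2 \<alpha>\<^sub>3 u v w)"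
  shows "Q x"
proof -
  let ?P = "\<lambda>(\<alpha>\<^sub>1, \<alpha>\<^sub>2, \<alpha>\<^sub>3). composable3 \<pi> \<alpha>\<^sub>1 \<alpha>\<^sub>2 \<alpha>\<^sub>3 \<and> cmp \<pi> \<alpha>\<^sub>3 (cmp \<pi> \<alpha>\<^sub>2 \<alpha>\<^sub>1) = \<gamma>"
  let ?T = "\<lambda>(\<alpha>\<^sub>1, \<alpha>\<^sub>2, \<alpha>\<^sub>3). {tensor3 sc u v w | u v w. u \<in> V \<alpha>\<^sub>1 \<and> v \<in> V \<alpha>\<^sub>2 \<and> w \<in> V \<alpha>\<^sub>3}"
  have "x \<in> gscale.span {(\<lambda>q. if q = p then t else 0) | p t. ?P p \<and> t \<in> ?T p}"
  proof (rule finite_support_in_span)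
    show "finite {p. x p \<noteq> 0}"
      using x by (simp add: graded_tensor3_def)
    fix p :: "'m \<times> 'm \<times> 'm"
    obtain \<alpha>\<^sub>1 \<alpha>\<^sub>2 \<alpha>\<^sub>3 where p: "p = (\<alpha>\<^sub>1, \<alpha>\<^sub>2, \<alpha>\<^sub>3)"
      by (cases p)
    have "x (\<alpha>\<^sub>1, \<alpha>\<^sub>2, \<alpha>\<^sub>3) \<in> (if ?P (\<alpha>\<^sub>1, \<alpha>\<^sub>2, \<alpha>\<^sub>3) then tensor_space3 sc (V \<alpha>\<^sub>1) (V \<alpha>\<^sub>2) (V \<alpha>\<^sub>3) else {0})"
      using x by (simp add: graded_tensor3_def)
    then show "x p \<in> (if ?P p then tscale.span (?T p) else {0})"
      by (simp only: p tensor_space3_def prod.case)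
  qed
  then have "x \<in> VVV \<gamma> \<and> Q x"
  proof (rule gscale.span_induct)
    show "gscale.subspace {x. x \<in> VVV \<gamma> \<and> Q x}"
      by (rule gscale.subspaceI) (auto simp: VVV_closed zero add scale)
  next
    fix y assume "y \<in> {(\<lambda>q. if q = p then t else 0) | p t. ?P p \<and> t \<in> ?T p}"
    then obtain \<alpha>\<^sub>1 \<alpha>\<^sub>2 \<alpha>\<^sub>3 u v w where "composable3 \<pi> \<alpha>\<^sub>1 \<alpha>\<^sub>2 \<alpha>\<^sub>3" "cmp \<pi> \<alpha>\<^sub>3 (cmp \<pi> \<alpha>\<^sub>2 \<alpha>\<^sub>1) = \<gamma>"
      "u \<in> V \<alpha>\<^sub>1" "v \<in> V \<alpha>\<^sub>2" "w \<in> V \<alpha>\<^sub>3" "y = pure3 sc \<alpha>\<^sub>1 \<alpha>\<^sub>2 \<alpha>\<^sub>3 u v w"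
      by (auto simp: pure3_def)
    then show "y \<in> VVV \<gamma> \<and> Q y"
      using pure3_in_VVV pure by metis
  qed
  then show ?thesis ..
qed

lemma linear_eq_on_VVV:
  assumes "linear_map_on gscale gscale (VVV \<gamma>) F" "linear_map_on gscale gscale (VVV \<gamma>) G"
    and "\<And>\<alpha>\<^sub>1 \<alpha>\<^sub>2 \<alpha>\<^sub>3 u v w. \<lbrakk>composable3 \<pi> \<alpha>\<^sub>1 \<alpha>\<^sub>2 \<alpha>\<^sub>3; cmp \<pi> \<alpha>\<^sub>3 (cmp \<pi> \<alpha>\<^sub>2 \<alpha>\<^sub>1) = \<gamma>;
        u \<in> V \<alpha>\<^sub>1; v \<in> V \<alpha>\<^sub>2; w \<in> V \<alpha>\<^sub>3\<rbrakk>
        \<Longrightarrow> F (pure3 sc \<alpha>\<^sub>1 \<alpha>\<^sub>2 \<alpha>\<^sub>3 u v w) = G (pure3 sc \<alpha>\<^sub>1 \<alpha>\<^sub>2 \<alpha>\<^sub>3 u v w)"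
    and "x \<in> VVV \<gamma>"
  shows "F x = G x"
  using assms(4)
proof (induction rule: VVV_induct)
  case zero
  then show ?case using assms(1,2) VVV_closed(1) linear_map_on_0 by metis
qed (use assms in \<open>auto simp: linear_map_on_def\<close>)

lemma linear_pure2:
  "linear_map_on sc gscale UNIV (\<lambda>u. pure2 sc \<alpha> \<beta> u v)"
  "linear_map_on sc gscale UNIV (\<lambda>v. pure2 sc \<alpha> \<beta> u v)"
  by (auto simp: linear_map_on_def pure2_def tensor2_def pointwise bilinear_form_def form_iff)

lemma trilinear_pure3: "trilinear_on sc A B C (pure3 sc \<alpha>\<^sub>1 \<alpha>\<^sub>2 \<alpha>\<^sub>3)"
  by (auto simp: trilinear_on_def linear_map_on_def pure3_def tensor3_def pointwise
      trilinear_form_def form_iff)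

lemma linear_pure3:
  "linear_map_on sc gscale UNIV (\<lambda>u. pure3 sc \<alpha>\<^sub>1 \<alpha>\<^sub>2 \<alpha>\<^sub>3 u v w)"
  "linear_map_on sc gscale UNIV (\<lambda>w. pure3 sc \<alpha>\<^sub>1 \<alpha>\<^sub>2 \<alpha>\<^sub>3 u v w)"
  by (auto simp: linear_map_on_def pure3_def tensor3_def pointwise trilinear_form_def form_iff)

section \<open>The universal property of the threefold tensor product\<close>

text \<open>
  A tensor is a functional on forms defined on the whole ambient space, whereas the operators are
  given only on the subspaces \<open>V \<alpha>\<close>. Linear projections onto these subspaces extend the one to the other.
\<close>
lemma ex_projection: "\<alpha> \<in> Arr \<pi> \<Longrightarrow>
  \<exists>p. range p \<subseteq> V \<alpha> \<and> Vector_Spaces.linear sc sc p \<and> (\<forall>v\<in>V \<alpha>. p v = v)"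
proof -
  assume "\<alpha> \<in> Arr \<pi>"
  interpret vector_space_pair sc sc ..
  have "Vector_Spaces.linear sc sc (\<lambda>v. v)" by (simp add: Vector_Spaces.linear_iff sc.vector_space_axioms)
  from linear_exists_left_inverse_on[OF this subspace_V[OF \<open>\<alpha> \<in> Arr \<pi>\<close>]]
  show ?thesis by auto
qed

text \<open>
  These triples index the pure tensors that can be nonzero; excluding trivial components makes
  the set finite, so that it can serve as the range of a sum.
\<close>
definition triples :: "'o \<Rightarrow> ('m \<times> 'm \<times> 'm) set" where
  "triples a = {(\<alpha>\<^sub>1, \<alpha>\<^sub>2, \<alpha>\<^sub>3). composable3 \<pi> \<alpha>\<^sub>1 \<alpha>\<^sub>2 \<alpha>\<^sub>3 \<and> src \<pi> \<alpha>\<^sub>1 = a \<and>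
     V \<alpha>\<^sub>1 \<noteq> {0} \<and> V \<alpha>\<^sub>2 \<noteq> {0} \<and> V \<alpha>\<^sub>3 \<noteq> {0}}"

lemma finite_triples:
  assumes "a \<in> Ob \<pi>"
  shows "finite (triples a)"
proof -
  define A where "A b = {\<alpha> \<in> Arr \<pi>. src \<pi> \<alpha> = b \<and> V \<alpha> \<noteq> {0}}" for b
  have A: "finite (A b)" if "b \<in> Ob \<pi>" for b
    by (rule finite_subset[of _ "{\<alpha> \<in> Arr \<pi>. (src \<pi> \<alpha> = b \<or> tgt \<pi> \<alpha> = b) \<and> V \<alpha> \<noteq> {0}}"])
      (use that finite_type in \<open>auto simp: A_def graded_finite_type_def\<close>)
  have "triples a \<subseteq> Sigma (A a) (\<lambda>\<alpha>\<^sub>1. Sigma (A (tgt \<pi> \<alpha>\<^sub>1)) (\<lambda>\<alpha>\<^sub>2. A (tgt \<pi> \<alpha>\<^sub>2)))"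
    by (auto simp: triples_def A_def composable3_def composable2_def)
  moreover have "finite \<dots>"
    using assms by (intro finite_SigmaI A) (auto simp: A_def tgt_in)
  ultimately show ?thesis by (rule finite_subset)
qed

lemma trilinear_eq_0:
  assumes "composable3 \<pi> \<alpha>\<^sub>1 \<alpha>\<^sub>2 \<alpha>\<^sub>3" "src \<pi> \<alpha>\<^sub>1 = a" "(\<alpha>\<^sub>1, \<alpha>\<^sub>2, \<alpha>\<^sub>3) \<notin> triples a"
    and "u \<in> V \<alpha>\<^sub>1" "v \<in> V \<alpha>\<^sub>2" "w \<in> V \<alpha>\<^sub>3"
    and g: "trilinear_on sc (V \<alpha>\<^sub>1) (V \<alpha>\<^sub>2) (V \<alpha>\<^sub>3) g"
  shows "g u v w = 0"
proof -
  have "0 \<in> V \<alpha>\<^sub>1" "0 \<in> V \<alpha>\<^sub>2" "0 \<in> V \<alpha>\<^sub>3"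
    using assms(1) subspace_V sc.subspace_0 by (auto simp: composable3_def composable2_def)
  moreover have "u = 0 \<or> v = 0 \<or> w = 0"
    using assms(1-6) by (auto simp: triples_def)
  ultimately show ?thesis
    using g assms(4-6) linear_map_on_0[where s\<^sub>1 = sc and s\<^sub>2 = gscale and F = "\<lambda>u. g u v w" and A = "V \<alpha>\<^sub>1"]
      linear_map_on_0[where s\<^sub>1 = sc and s\<^sub>2 = gscale and F = "\<lambda>v. g u v w" and A = "V \<alpha>\<^sub>2"]
      linear_map_on_0[where s\<^sub>1 = sc and s\<^sub>2 = gscale and F = "\<lambda>w. g u v w" and A = "V \<alpha>\<^sub>3"]
    unfolding trilinear_on_def by auto
qed

lemma finite_VVV_support:
  assumes "a \<in> Ob \<pi>"
  shows "finite {\<gamma> \<in> source_fiber \<pi> a. VVV \<gamma> \<noteq> {0}}"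
proof -
  have "{\<gamma> \<in> source_fiber \<pi> a. VVV \<gamma> \<noteq> {0}} \<subseteq> (\<lambda>(\<alpha>\<^sub>1, \<alpha>\<^sub>2, \<alpha>\<^sub>3). cmp \<pi> \<alpha>\<^sub>3 (cmp \<pi> \<alpha>\<^sub>2 \<alpha>\<^sub>1)) ` triples a"
  proof clarify
    fix \<gamma> assume \<gamma>: "\<gamma> \<in> source_fiber \<pi> a" "VVV \<gamma> \<noteq> {0}"
    show "\<gamma> \<in> (\<lambda>(\<alpha>\<^sub>1, \<alpha>\<^sub>2, \<alpha>\<^sub>3). cmp \<pi> \<alpha>\<^sub>3 (cmp \<pi> \<alpha>\<^sub>2 \<alpha>\<^sub>1)) ` triples a"
    proof (rule ccontr)
      assume not: "\<not> ?thesis"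
      have "x = 0" if "x \<in> VVV \<gamma>" for x
        using that
      proof (induction rule: VVV_induct)
        case (pure \<alpha>\<^sub>1 \<alpha>\<^sub>2 \<alpha>\<^sub>3 u v w)
        have "(\<alpha>\<^sub>1, \<alpha>\<^sub>2, \<alpha>\<^sub>3) \<notin> triples a" using not pure(2) by force
        moreover have "src \<pi> \<alpha>\<^sub>1 = a"
          using composable3_composite(3)[OF pure(1)] pure(2) \<gamma>(1) by (auto simp: source_fiber_def)
        moreover have "trilinear_on sc (V \<alpha>\<^sub>1) (V \<alpha>\<^sub>2) (V \<alpha>\<^sub>3) (pure3 sc \<alpha>\<^sub>1 \<alpha>\<^sub>2 \<alpha>\<^sub>3)"
          by (rule trilinear_pure3)
        ultimately show ?case using trilinear_eq_0 pure by blast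
      qed auto
      then show False using \<gamma>(2) VVV_closed(1) by blast
    qed
  qed
  then show ?thesis using finite_triples[OF assms] finite_surj by blast
qed

text \<open>
  Existence is proved by a formula with no choice of representation for the tensor. To compute the
  image of \<open>x\<close> at a form \<open>T\<close>, pull \<open>T\<close> back along \<open>G\<close>, extended by projections, to a trilinear form on
  the ambient space, evaluate \<open>x\<close> at it, and sum over the possible degrees. This is visibly linear
  in \<open>x\<close>, so that independence of a presentation of \<open>x\<close> as a sum of pure tensors is automatic.
\<close>
lemma ex1_fiber_End:
  assumes a: "a \<in> Ob \<pi>"
    and trilinear: "\<And>\<alpha>\<^sub>1 \<alpha>\<^sub>2 \<alpha>\<^sub>3. \<lbrakk>composable3 \<pi> \<alpha>\<^sub>1 \<alpha>\<^sub>2 \<alpha>\<^sub>3; src \<pi> \<alpha>\<^sub>1 = a\<rbrakk>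
      \<Longrightarrow> trilinear_on sc (V \<alpha>\<^sub>1) (V \<alpha>\<^sub>2) (V \<alpha>\<^sub>3) (G \<alpha>\<^sub>1 \<alpha>\<^sub>2 \<alpha>\<^sub>3)"
    and range: "\<And>\<alpha>\<^sub>1 \<alpha>\<^sub>2 \<alpha>\<^sub>3 u v w. \<lbrakk>composable3 \<pi> \<alpha>\<^sub>1 \<alpha>\<^sub>2 \<alpha>\<^sub>3; src \<pi> \<alpha>\<^sub>1 = a;
        u \<in> V \<alpha>\<^sub>1; v \<in> V \<alpha>\<^sub>2; w \<in> V \<alpha>\<^sub>3\<rbrakk> \<Longrightarrow> G \<alpha>\<^sub>1 \<alpha>\<^sub>2 \<alpha>\<^sub>3 u v w \<in> VVV (cmp \<pi> \<alpha>\<^sub>3 (cmp \<pi> \<alpha>\<^sub>2 \<alpha>\<^sub>1))"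
  shows "\<exists>!F. F \<in> fiber_End \<pi> VVV a \<and>
     (\<forall>\<gamma> x. \<gamma> \<notin> source_fiber \<pi> a \<or> x \<notin> VVV \<gamma> \<longrightarrow> F \<gamma> x = 0) \<and>
     (\<forall>\<alpha>\<^sub>1 \<alpha>\<^sub>2 \<alpha>\<^sub>3. \<forall>u\<in>V \<alpha>\<^sub>1. \<forall>v\<in>V \<alpha>\<^sub>2. \<forall>w\<in>V \<alpha>\<^sub>3. composable3 \<pi> \<alpha>\<^sub>1 \<alpha>\<^sub>2 \<alpha>\<^sub>3 \<and> src \<pi> \<alpha>\<^sub>1 = a \<longrightarrow>
        F (cmp \<pi> \<alpha>\<^sub>3 (cmp \<pi> \<alpha>\<^sub>2 \<alpha>\<^sub>1)) (pure3 sc \<alpha>\<^sub>1 \<alpha>\<^sub>2 \<alpha>\<^sub>3 u v w) = G \<alpha>\<^sub>1 \<alpha>\<^sub>2 \<alpha>\<^sub>3 u v w)"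
    (is "\<exists>!F. ?spec F")
proof -
  obtain P where P: "\<And>\<alpha> v. \<alpha> \<in> Arr \<pi> \<Longrightarrow> P \<alpha> v \<in> V \<alpha>"
    "\<And>\<alpha>. \<alpha> \<in> Arr \<pi> \<Longrightarrow> Vector_Spaces.linear sc sc (P \<alpha>)"
    "\<And>\<alpha> v. \<alpha> \<in> Arr \<pi> \<Longrightarrow> v \<in> V \<alpha> \<Longrightarrow> P \<alpha> v = v"
    using ex_projection by (metis rangeI subsetD)
  have P_add: "P \<alpha> (u + v) = P \<alpha> u + P \<alpha> v" and P_scale: "P \<alpha> (sc c u) = sc c (P \<alpha> u)"
    if "\<alpha> \<in> Arr \<pi>" for \<alpha> u v c
    using P(2)[OF that] by (auto simp: Vector_Spaces.linear_iff)
  \<comment> \<open>\<open>H p q T\<close> pulls the component at degrees \<open>q\<close> of the result, tested against \<open>T\<close>, back to degrees \<open>p\<close>.\<close>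
  define H where "H p q T u v w = (case p of (\<alpha>\<^sub>1, \<alpha>\<^sub>2, \<alpha>\<^sub>3) \<Rightarrow>
      G \<alpha>\<^sub>1 \<alpha>\<^sub>2 \<alpha>\<^sub>3 (P \<alpha>\<^sub>1 u) (P \<alpha>\<^sub>2 v) (P \<alpha>\<^sub>3 w) q T)" for p q T u v w
  have H_form: "trilinear_form sc (H p q T)" if "p \<in> triples a" for p q T
  proof -
    obtain \<alpha>\<^sub>1 \<alpha>\<^sub>2 \<alpha>\<^sub>3 where p: "p = (\<alpha>\<^sub>1, \<alpha>\<^sub>2, \<alpha>\<^sub>3)" by (cases p)
    have c: "composable3 \<pi> \<alpha>\<^sub>1 \<alpha>\<^sub>2 \<alpha>\<^sub>3" "src \<pi> \<alpha>\<^sub>1 = a"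
      using that by (auto simp: p triples_def)
    then have arr: "\<alpha>\<^sub>1 \<in> Arr \<pi>" "\<alpha>\<^sub>2 \<in> Arr \<pi>" "\<alpha>\<^sub>3 \<in> Arr \<pi>"
      by (auto simp: composable3_def composable2_def)
    show ?thesis
      using trilinear[OF c] arr
      by (simp add: trilinear_form_def form_iff H_def p P_add P_scale P(1) trilinear_on_def
          linear_map_on_def plus_fun_apply gscale_apply)
  qed
  define E :: "('m, 'v) gtens3 \<Rightarrow> ('m, 'v) gtens3" where
    "E x = (\<lambda>q T. \<Sum>p\<in>triples a. x p (H p q T))" for x
  have E_linear: "E (x + y) = E x + E y" "E (gscale c x) = gscale c (E x)" for x y c
    by (auto simp: E_def pointwise sum.distrib sum_distrib_left)
  have E_0: "E 0 = 0"
    by (auto simp: E_def pointwise)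
  have E_pure: "E (pure3 sc \<alpha>\<^sub>1 \<alpha>\<^sub>2 \<alpha>\<^sub>3 u v w) = G \<alpha>\<^sub>1 \<alpha>\<^sub>2 \<alpha>\<^sub>3 u v w"
    if c: "composable3 \<pi> \<alpha>\<^sub>1 \<alpha>\<^sub>2 \<alpha>\<^sub>3" "src \<pi> \<alpha>\<^sub>1 = a" and uvw: "u \<in> V \<alpha>\<^sub>1" "v \<in> V \<alpha>\<^sub>2" "w \<in> V \<alpha>\<^sub>3"
    for \<alpha>\<^sub>1 \<alpha>\<^sub>2 \<alpha>\<^sub>3 u v w
  proof (cases "(\<alpha>\<^sub>1, \<alpha>\<^sub>2, \<alpha>\<^sub>3) \<in> triples a")
    case True
    have arr: "\<alpha>\<^sub>1 \<in> Arr \<pi>" "\<alpha>\<^sub>2 \<in> Arr \<pi>" "\<alpha>\<^sub>3 \<in> Arr \<pi>"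
      using c by (auto simp: composable3_def composable2_def)
    show ?thesis
    proof (intro ext)
      fix q T
      have "E (pure3 sc \<alpha>\<^sub>1 \<alpha>\<^sub>2 \<alpha>\<^sub>3 u v w) q T =
        (\<Sum>p\<in>triples a. if p = (\<alpha>\<^sub>1, \<alpha>\<^sub>2, \<alpha>\<^sub>3) then H p q T u v w else 0)"
        unfolding E_def by (rule sum.cong) (auto simp: pure3_def tensor3_def H_form zero_fun_apply)
      also have "\<dots> = H (\<alpha>\<^sub>1, \<alpha>\<^sub>2, \<alpha>\<^sub>3) q T u v w"
        using True finite_triples[OF a] by simp
      also have "\<dots> = G \<alpha>\<^sub>1 \<alpha>\<^sub>2 \<alpha>\<^sub>3 u v w q T"
        using P(3) arr uvw by (simp add: H_def)
      finally show "E (pure3 sc \<alpha>\<^sub>1 \<alpha>\<^sub>2 \<alpha>\<^sub>3 u v w) q T = G \<alpha>\<^sub>1 \<alpha>\<^sub>2 \<alpha>\<^sub>3 u v w q T" .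
    qed
  next
    case False
    have "trilinear_on sc (V \<alpha>\<^sub>1) (V \<alpha>\<^sub>2) (V \<alpha>\<^sub>3) (pure3 sc \<alpha>\<^sub>1 \<alpha>\<^sub>2 \<alpha>\<^sub>3)"
      by (rule trilinear_pure3)
    from trilinear_eq_0[OF c False uvw this] trilinear_eq_0[OF c False uvw trilinear[OF c]]
    show ?thesis by (simp add: E_0)
  qed
  have E_VVV: "E x \<in> VVV \<gamma>" if "x \<in> VVV \<gamma>" "\<gamma> \<in> source_fiber \<pi> a" for x \<gamma>
    using that(1)
  proof (induction rule: VVV_induct)
    case zero
    show ?case by (simp add: E_0 VVV_closed)
  next
    case (pure \<alpha>\<^sub>1 \<alpha>\<^sub>2 \<alpha>\<^sub>3 u v w)
    have "src \<pi> \<alpha>\<^sub>1 = a"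
      using composable3_composite(3)[OF pure(1)] pure(2) that(2) by (auto simp: source_fiber_def)
    with pure show ?case using E_pure range by metis
  qed (auto simp: E_linear VVV_closed)
  define F where "F \<gamma> x = (if \<gamma> \<in> source_fiber \<pi> a \<and> x \<in> VVV \<gamma> then E x else 0)" for \<gamma> x
  have "F \<in> fiber_End \<pi> VVV a"
  proof -
    have "finite {\<gamma> \<in> source_fiber \<pi> a. \<exists>x\<in>VVV \<gamma>. F \<gamma> x \<noteq> 0}"
    proof (rule finite_subset[OF _ finite_VVV_support[OF a]], clarify)
      fix \<gamma> x assume x: "x \<in> VVV \<gamma>" "F \<gamma> x \<noteq> 0" and triv: "VVV \<gamma> = {0}"
      then have "x = 0" by blast
      then have "F \<gamma> x = 0" by (simp add: F_def E_0)
      with x show False by simp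
    qed
    then show ?thesis
      by (auto simp: fiber_End_def endo_on_def F_def E_linear E_VVV VVV_closed)
  qed
  then have F: "?spec F"
    using E_pure composable3_composite(3) pure3_in_VVV by (auto simp: F_def)
  show ?thesis
  proof (rule ex1I[of ?spec F])
    show "?spec F" by (rule F)
  next
    fix F' assume F': "?spec F'"
    show "F' = F"
    proof (rule ext, rule ext)
      fix \<gamma> x
      show "F' \<gamma> x = F \<gamma> x"
      proof (cases "\<gamma> \<in> source_fiber \<pi> a \<and> x \<in> VVV \<gamma>")
        case True
        then have "linear_map_on gscale gscale (VVV \<gamma>) (F' \<gamma>)" "linear_map_on gscale gscale (VVV \<gamma>) (F \<gamma>)"
          using F F' by (auto simp: fiber_End_def endo_on_iff)
        then show ?thesis
        proof (rule linear_eq_on_VVV[where F = "F' \<gamma>" and G = "F \<gamma>"])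
          fix \<alpha>\<^sub>1 \<alpha>\<^sub>2 \<alpha>\<^sub>3 u v w
          assume c: "composable3 \<pi> \<alpha>\<^sub>1 \<alpha>\<^sub>2 \<alpha>\<^sub>3" "cmp \<pi> \<alpha>\<^sub>3 (cmp \<pi> \<alpha>\<^sub>2 \<alpha>\<^sub>1) = \<gamma>"
            and uvw: "u \<in> V \<alpha>\<^sub>1" "v \<in> V \<alpha>\<^sub>2" "w \<in> V \<alpha>\<^sub>3"
          have "src \<pi> \<alpha>\<^sub>1 = a"
            using composable3_composite(3)[OF c(1)] c(2) True by (auto simp: source_fiber_def)
          with F F' c uvw
          have "F' \<gamma> (pure3 sc \<alpha>\<^sub>1 \<alpha>\<^sub>2 \<alpha>\<^sub>3 u v w) = G \<alpha>\<^sub>1 \<alpha>\<^sub>2 \<alpha>\<^sub>3 u v w"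
            "F \<gamma> (pure3 sc \<alpha>\<^sub>1 \<alpha>\<^sub>2 \<alpha>\<^sub>3 u v w) = G \<alpha>\<^sub>1 \<alpha>\<^sub>2 \<alpha>\<^sub>3 u v w"
            by blast+
          then show "F' \<gamma> (pure3 sc \<alpha>\<^sub>1 \<alpha>\<^sub>2 \<alpha>\<^sub>3 u v w) = F \<gamma> (pure3 sc \<alpha>\<^sub>1 \<alpha>\<^sub>2 \<alpha>\<^sub>3 u v w)"
            by simp
        qed (use True in simp)
      next
        case False
        then have "F' \<gamma> x = 0" "F \<gamma> x = 0" using F F' by blast+
        then show ?thesis by simp
      qed
    qed
  qed
qed

section \<open>The operators acting on two of the three factors\<close>

lemma linear_tensor_vec: "linear_map_on gscale gscale UNIV (\<lambda>x. tensor_vec sc x \<alpha> w)"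
  by (auto simp: linear_map_on_def tensor_vec_def pointwise)

lemma linear_vec_tensor: "linear_map_on gscale gscale UNIV (\<lambda>x. vec_tensor sc \<alpha> u x)"
  by (auto simp: linear_map_on_def vec_tensor_def pointwise)

lemmas tensor_vec_add = linear_tensor_vec[unfolded linear_map_on_def, THEN conjunct1, rule_format, OF UNIV_I UNIV_I]
lemmas tensor_vec_scale = linear_tensor_vec[unfolded linear_map_on_def, THEN conjunct2, rule_format, OF UNIV_I]
lemmas vec_tensor_add = linear_vec_tensor[unfolded linear_map_on_def, THEN conjunct1, rule_format, OF UNIV_I UNIV_I]
lemmas vec_tensor_scale = linear_vec_tensor[unfolded linear_map_on_def, THEN conjunct2, rule_format, OF UNIV_I]

lemma tensor_vec_0 [simp]: "tensor_vec sc 0 \<alpha> w = 0" "vec_tensor sc \<alpha> w 0 = 0"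
  by (auto simp: tensor_vec_def vec_tensor_def pointwise)

text \<open>
  Linearity in the vector fails for arbitrary functionals \<open>y\<close>; it holds on \<open>VV \<delta>\<close> because it holds for
  pure tensors.
\<close>
lemma linear_tensor_vec_vec:
  assumes "y \<in> VV \<delta>"
  shows "linear_map_on sc gscale UNIV (\<lambda>w. tensor_vec sc y \<alpha> w)"
  using assms
proof (induction rule: VV_induct)
  case (pure \<alpha>\<^sub>1 \<alpha>\<^sub>2 u v)
  show ?case
    unfolding tensor_vec_pure2 by (rule linear_pure3)
next
  case zero
  show ?case by (simp add: linear_map_on_def)
next
  case (add x y)
  from linear_map_on_add[OF add(3,4)] show ?case unfolding tensor_vec_add .
next
  case (scale c x)
  from linear_map_on_scale[OF scale(2)] show ?case unfolding tensor_vec_scale .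
qed

lemma linear_vec_tensor_vec:
  assumes "y \<in> VV \<delta>"
  shows "linear_map_on sc gscale UNIV (\<lambda>u. vec_tensor sc \<alpha> u y)"
  using assms
proof (induction rule: VV_induct)
  case (pure \<alpha>\<^sub>1 \<alpha>\<^sub>2 u v)
  show ?case
    unfolding vec_tensor_pure2 by (rule linear_pure3)
next
  case zero
  show ?case by (simp add: linear_map_on_def)
next
  case (add x y)
  from linear_map_on_add[OF add(3,4)] show ?case unfolding vec_tensor_add .
next
  case (scale c x)
  from linear_map_on_scale[OF scale(2)] show ?case unfolding vec_tensor_scale .
qed

lemma composable3_left:
  assumes "composable2 \<pi> \<beta>\<^sub>1 \<beta>\<^sub>2" "composable2 \<pi> (cmp \<pi> \<beta>\<^sub>2 \<beta>\<^sub>1) \<alpha>"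
  shows "composable3 \<pi> \<beta>\<^sub>1 \<beta>\<^sub>2 \<alpha>"
  using assms by (auto simp: composable3_def composable2_def tgt_cmp)

lemma composable3_right:
  assumes "composable2 \<pi> \<beta>\<^sub>1 \<beta>\<^sub>2" "composable2 \<pi> \<alpha> (cmp \<pi> \<beta>\<^sub>2 \<beta>\<^sub>1)"
  shows "composable3 \<pi> \<alpha> \<beta>\<^sub>1 \<beta>\<^sub>2"
  using assms by (auto simp: composable3_def composable2_def src_cmp)

lemma tensor_vec_in_VVV:
  assumes "y \<in> VV \<delta>" "composable2 \<pi> \<delta> \<alpha>" "w \<in> V \<alpha>"
  shows "tensor_vec sc y \<alpha> w \<in> VVV (cmp \<pi> \<alpha> \<delta>)"
  using assms(1)
proof (induction rule: VV_induct)
  case (pure \<beta>\<^sub>1 \<beta>\<^sub>2 u v)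
  have "composable3 \<pi> \<beta>\<^sub>1 \<beta>\<^sub>2 \<alpha>"
    using composable3_left pure(1,2) assms(2) by metis
  from pure3_in_VVV[OF this pure(3,4) assms(3)] show ?case
    by (simp add: tensor_vec_pure2 pure(2))
qed (simp_all add: tensor_vec_add tensor_vec_scale VVV_closed)

lemma vec_tensor_in_VVV:
  assumes "y \<in> VV \<delta>" "composable2 \<pi> \<alpha> \<delta>" "u \<in> V \<alpha>"
  shows "vec_tensor sc \<alpha> u y \<in> VVV (cmp \<pi> \<delta> \<alpha>)"
  using assms(1)
proof (induction rule: VV_induct)
  case (pure \<beta>\<^sub>1 \<beta>\<^sub>2 v w)
  have c: "composable3 \<pi> \<alpha> \<beta>\<^sub>1 \<beta>\<^sub>2"
    using composable3_right pure(1,2) assms(2) by metis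
  from pure3_in_VVV[OF c assms(3) pure(3,4)] show ?case
    by (simp add: vec_tensor_pure2 pure(2) composable3_composite(5)[OF c])
qed (simp_all add: vec_tensor_add vec_tensor_scale VVV_closed)

definition endo_family :: "('o \<Rightarrow> ('m, ('m, 'v) gtens2) fiber_op) \<Rightarrow> bool" where
  "endo_family X \<longleftrightarrow> (\<forall>b\<in>Ob \<pi>. \<forall>\<delta>\<in>source_fiber \<pi> b. endo_on (VV \<delta>) (X b \<delta>))"

lemma endo_familyD:
  assumes "endo_family X" "composable2 \<pi> \<alpha> \<beta>" "src \<pi> \<alpha> = b"
  shows "endo_on (VV (cmp \<pi> \<beta> \<alpha>)) (X b (cmp \<pi> \<beta> \<alpha>))"
  using assms by (auto simp: endo_family_def source_fiber_def composable2_def src_in cmp_in src_cmp)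

lemma bilinear_endo_family:
  assumes "endo_family X" "composable2 \<pi> \<alpha> \<beta>" "src \<pi> \<alpha> = b" "u \<in> V \<alpha>" "v \<in> V \<beta>"
  shows "linear_map_on sc gscale (V \<alpha>) (\<lambda>u. X b (cmp \<pi> \<beta> \<alpha>) (pure2 sc \<alpha> \<beta> u v))"
    and "linear_map_on sc gscale (V \<beta>) (\<lambda>v. X b (cmp \<pi> \<beta> \<alpha>) (pure2 sc \<alpha> \<beta> u v))"
    and "X b (cmp \<pi> \<beta> \<alpha>) (pure2 sc \<alpha> \<beta> u v) \<in> VV (cmp \<pi> \<beta> \<alpha>)"
  using endo_familyD[OF assms(1-3)] pure2_in_VV[OF assms(2)] assms(4,5)
    linear_pure2(1)[of \<alpha> \<beta>] linear_pure2(2)[of \<alpha> \<beta>]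
  by (simp_all add: linear_map_on_def endo_on_def)

lemma op12_spec:
  assumes X: "endo_family X" and a: "a \<in> Ob \<pi>"
  shows "op12 \<pi> sc V X a \<in> fiber_End \<pi> VVV a"
    and "\<lbrakk>composable3 \<pi> \<alpha>\<^sub>1 \<alpha>\<^sub>2 \<alpha>\<^sub>3; src \<pi> \<alpha>\<^sub>1 = a; u \<in> V \<alpha>\<^sub>1; v \<in> V \<alpha>\<^sub>2; w \<in> V \<alpha>\<^sub>3\<rbrakk>
      \<Longrightarrow> op12 \<pi> sc V X a (cmp \<pi> \<alpha>\<^sub>3 (cmp \<pi> \<alpha>\<^sub>2 \<alpha>\<^sub>1)) (pure3 sc \<alpha>\<^sub>1 \<alpha>\<^sub>2 \<alpha>\<^sub>3 u v w) =
        tensor_vec sc (X a (cmp \<pi> \<alpha>\<^sub>2 \<alpha>\<^sub>1) (pure2 sc \<alpha>\<^sub>1 \<alpha>\<^sub>2 u v)) \<alpha>\<^sub>3 w"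
proof -
  define G where
    "G \<alpha>\<^sub>1 \<alpha>\<^sub>2 \<alpha>\<^sub>3 u v w = tensor_vec sc (X a (cmp \<pi> \<alpha>\<^sub>2 \<alpha>\<^sub>1) (pure2 sc \<alpha>\<^sub>1 \<alpha>\<^sub>2 u v)) \<alpha>\<^sub>3 w"
    for \<alpha>\<^sub>1 \<alpha>\<^sub>2 \<alpha>\<^sub>3 u v w
  have "trilinear_on sc (V \<alpha>\<^sub>1) (V \<alpha>\<^sub>2) (V \<alpha>\<^sub>3) (G \<alpha>\<^sub>1 \<alpha>\<^sub>2 \<alpha>\<^sub>3)"
    if "composable3 \<pi> \<alpha>\<^sub>1 \<alpha>\<^sub>2 \<alpha>\<^sub>3" "src \<pi> \<alpha>\<^sub>1 = a" for \<alpha>\<^sub>1 \<alpha>\<^sub>2 \<alpha>\<^sub>3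
  proof -
    have c: "composable2 \<pi> \<alpha>\<^sub>1 \<alpha>\<^sub>2" using that(1) by (simp add: composable3_def)
    show ?thesis
      using bilinear_endo_family(1,2)[OF X c that(2)]
        linear_tensor_vec_vec[OF bilinear_endo_family(3)[OF X c that(2)]]
      by (simp add: trilinear_on_def G_def linear_map_on_def tensor_vec_add tensor_vec_scale)
  qed
  moreover have "G \<alpha>\<^sub>1 \<alpha>\<^sub>2 \<alpha>\<^sub>3 u v w \<in> VVV (cmp \<pi> \<alpha>\<^sub>3 (cmp \<pi> \<alpha>\<^sub>2 \<alpha>\<^sub>1))"
    if "composable3 \<pi> \<alpha>\<^sub>1 \<alpha>\<^sub>2 \<alpha>\<^sub>3" "src \<pi> \<alpha>\<^sub>1 = a" "u \<in> V \<alpha>\<^sub>1" "v \<in> V \<alpha>\<^sub>2" "w \<in> V \<alpha>\<^sub>3" for \<alpha>\<^sub>1 \<alpha>\<^sub>2 \<alpha>\<^sub>3 u v w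
    unfolding G_def
    using that composable3_composite(1,4)[OF that(1)]
    by (intro tensor_vec_in_VVV bilinear_endo_family(3)[OF X])
      (auto simp: composable3_def composable2_def source_fiber_def)
  ultimately have "\<exists>!F. F \<in> fiber_End \<pi> VVV a \<and>
     (\<forall>\<gamma> x. \<gamma> \<notin> source_fiber \<pi> a \<or> x \<notin> VVV \<gamma> \<longrightarrow> F \<gamma> x = 0) \<and>
     (\<forall>\<alpha>\<^sub>1 \<alpha>\<^sub>2 \<alpha>\<^sub>3. \<forall>u\<in>V \<alpha>\<^sub>1. \<forall>v\<in>V \<alpha>\<^sub>2. \<forall>w\<in>V \<alpha>\<^sub>3. composable3 \<pi> \<alpha>\<^sub>1 \<alpha>\<^sub>2 \<alpha>\<^sub>3 \<and> src \<pi> \<alpha>\<^sub>1 = a \<longrightarrow>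
        F (cmp \<pi> \<alpha>\<^sub>3 (cmp \<pi> \<alpha>\<^sub>2 \<alpha>\<^sub>1)) (pure3 sc \<alpha>\<^sub>1 \<alpha>\<^sub>2 \<alpha>\<^sub>3 u v w) = G \<alpha>\<^sub>1 \<alpha>\<^sub>2 \<alpha>\<^sub>3 u v w)"
    by (rule ex1_fiber_End[OF a])
  from theI'[OF this, unfolded G_def, folded op12_def]
  show "op12 \<pi> sc V X a \<in> fiber_End \<pi> VVV a"
    and "\<lbrakk>composable3 \<pi> \<alpha>\<^sub>1 \<alpha>\<^sub>2 \<alpha>\<^sub>3; src \<pi> \<alpha>\<^sub>1 = a; u \<in> V \<alpha>\<^sub>1; v \<in> V \<alpha>\<^sub>2; w \<in> V \<alpha>\<^sub>3\<rbrakk>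
      \<Longrightarrow> op12 \<pi> sc V X a (cmp \<pi> \<alpha>\<^sub>3 (cmp \<pi> \<alpha>\<^sub>2 \<alpha>\<^sub>1)) (pure3 sc \<alpha>\<^sub>1 \<alpha>\<^sub>2 \<alpha>\<^sub>3 u v w) =
        tensor_vec sc (X a (cmp \<pi> \<alpha>\<^sub>2 \<alpha>\<^sub>1) (pure2 sc \<alpha>\<^sub>1 \<alpha>\<^sub>2 u v)) \<alpha>\<^sub>3 w"
    by blast+
qed

lemma op23_spec:
  assumes X: "endo_family X" and a: "a \<in> Ob \<pi>"
  shows "op23 \<pi> sc V X a \<in> fiber_End \<pi> VVV a"
    and "\<lbrakk>composable3 \<pi> \<alpha>\<^sub>1 \<alpha>\<^sub>2 \<alpha>\<^sub>3; src \<pi> \<alpha>\<^sub>1 = a; u \<in> V \<alpha>\<^sub>1; v \<in> V \<alpha>\<^sub>2; w \<in> V \<alpha>\<^sub>3\<rbrakk>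
      \<Longrightarrow> op23 \<pi> sc V X a (cmp \<pi> \<alpha>\<^sub>3 (cmp \<pi> \<alpha>\<^sub>2 \<alpha>\<^sub>1)) (pure3 sc \<alpha>\<^sub>1 \<alpha>\<^sub>2 \<alpha>\<^sub>3 u v w) =
        vec_tensor sc \<alpha>\<^sub>1 u (X (tgt \<pi> \<alpha>\<^sub>1) (cmp \<pi> \<alpha>\<^sub>3 \<alpha>\<^sub>2) (pure2 sc \<alpha>\<^sub>2 \<alpha>\<^sub>3 v w))"
proof -
  define G where
    "G \<alpha>\<^sub>1 \<alpha>\<^sub>2 \<alpha>\<^sub>3 u v w =
       vec_tensor sc \<alpha>\<^sub>1 u (X (tgt \<pi> \<alpha>\<^sub>1) (cmp \<pi> \<alpha>\<^sub>3 \<alpha>\<^sub>2) (pure2 sc \<alpha>\<^sub>2 \<alpha>\<^sub>3 v w))"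
    for \<alpha>\<^sub>1 \<alpha>\<^sub>2 \<alpha>\<^sub>3 u v w
  have "trilinear_on sc (V \<alpha>\<^sub>1) (V \<alpha>\<^sub>2) (V \<alpha>\<^sub>3) (G \<alpha>\<^sub>1 \<alpha>\<^sub>2 \<alpha>\<^sub>3)"
    if "composable3 \<pi> \<alpha>\<^sub>1 \<alpha>\<^sub>2 \<alpha>\<^sub>3" "src \<pi> \<alpha>\<^sub>1 = a" for \<alpha>\<^sub>1 \<alpha>\<^sub>2 \<alpha>\<^sub>3
  proof -
    have c: "composable2 \<pi> \<alpha>\<^sub>2 \<alpha>\<^sub>3" "src \<pi> \<alpha>\<^sub>2 = tgt \<pi> \<alpha>\<^sub>1"
      using that(1) by (auto simp: composable3_def composable2_def)
    show ?thesis
      using bilinear_endo_family(1,2)[OF X c]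
        linear_vec_tensor_vec[OF bilinear_endo_family(3)[OF X c]]
      by (simp add: trilinear_on_def G_def linear_map_on_def vec_tensor_add vec_tensor_scale)
  qed
  moreover have "G \<alpha>\<^sub>1 \<alpha>\<^sub>2 \<alpha>\<^sub>3 u v w \<in> VVV (cmp \<pi> \<alpha>\<^sub>3 (cmp \<pi> \<alpha>\<^sub>2 \<alpha>\<^sub>1))"
    if "composable3 \<pi> \<alpha>\<^sub>1 \<alpha>\<^sub>2 \<alpha>\<^sub>3" "src \<pi> \<alpha>\<^sub>1 = a" "u \<in> V \<alpha>\<^sub>1" "v \<in> V \<alpha>\<^sub>2" "w \<in> V \<alpha>\<^sub>3" for \<alpha>\<^sub>1 \<alpha>\<^sub>2 \<alpha>\<^sub>3 u v w
    unfolding G_def composable3_composite(5)[OF that(1)]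
    using that composable3_composite(2)[OF that(1)]
    by (intro vec_tensor_in_VVV bilinear_endo_family(3)[OF X])
      (auto simp: composable3_def composable2_def source_fiber_def)
  ultimately have "\<exists>!F. F \<in> fiber_End \<pi> VVV a \<and>
     (\<forall>\<gamma> x. \<gamma> \<notin> source_fiber \<pi> a \<or> x \<notin> VVV \<gamma> \<longrightarrow> F \<gamma> x = 0) \<and>
     (\<forall>\<alpha>\<^sub>1 \<alpha>\<^sub>2 \<alpha>\<^sub>3. \<forall>u\<in>V \<alpha>\<^sub>1. \<forall>v\<in>V \<alpha>\<^sub>2. \<forall>w\<in>V \<alpha>\<^sub>3. composable3 \<pi> \<alpha>\<^sub>1 \<alpha>\<^sub>2 \<alpha>\<^sub>3 \<and> src \<pi> \<alpha>\<^sub>1 = a \<longrightarrow>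
        F (cmp \<pi> \<alpha>\<^sub>3 (cmp \<pi> \<alpha>\<^sub>2 \<alpha>\<^sub>1)) (pure3 sc \<alpha>\<^sub>1 \<alpha>\<^sub>2 \<alpha>\<^sub>3 u v w) = G \<alpha>\<^sub>1 \<alpha>\<^sub>2 \<alpha>\<^sub>3 u v w)"
    by (rule ex1_fiber_End[OF a])
  from theI'[OF this, unfolded G_def, folded op23_def]
  show "op23 \<pi> sc V X a \<in> fiber_End \<pi> VVV a"
    and "\<lbrakk>composable3 \<pi> \<alpha>\<^sub>1 \<alpha>\<^sub>2 \<alpha>\<^sub>3; src \<pi> \<alpha>\<^sub>1 = a; u \<in> V \<alpha>\<^sub>1; v \<in> V \<alpha>\<^sub>2; w \<in> V \<alpha>\<^sub>3\<rbrakk>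
      \<Longrightarrow> op23 \<pi> sc V X a (cmp \<pi> \<alpha>\<^sub>3 (cmp \<pi> \<alpha>\<^sub>2 \<alpha>\<^sub>1)) (pure3 sc \<alpha>\<^sub>1 \<alpha>\<^sub>2 \<alpha>\<^sub>3 u v w) =
        vec_tensor sc \<alpha>\<^sub>1 u (X (tgt \<pi> \<alpha>\<^sub>1) (cmp \<pi> \<alpha>\<^sub>3 \<alpha>\<^sub>2) (pure2 sc \<alpha>\<^sub>2 \<alpha>\<^sub>3 v w))"
    by blast+
qed

lemma op12_endo:
  "\<lbrakk>endo_family X; \<gamma> \<in> source_fiber \<pi> a\<rbrakk> \<Longrightarrow> endo_on (VVV \<gamma>) (op12 \<pi> sc V X a \<gamma>)"
  using op12_spec(1) by (auto simp: fiber_End_def source_fiber_def src_in)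

lemma op23_endo:
  "\<lbrakk>endo_family X; \<gamma> \<in> source_fiber \<pi> a\<rbrakk> \<Longrightarrow> endo_on (VVV \<gamma>) (op23 \<pi> sc V X a \<gamma>)"
  using op23_spec(1) by (auto simp: fiber_End_def source_fiber_def src_in)

text \<open>
  The formula for \<open>op12\<close> on pure tensors extends to \<open>y \<otimes> w\<close> for every \<open>y\<close> in \<open>V \<otimes> V\<close>. This is what
  allows \<open>op12\<close> to be iterated: \<open>X\<close> need not map pure tensors to pure tensors.
\<close>
lemma op12_tensor_vec:
  assumes X: "endo_family X" and y: "y \<in> VV \<delta>" and c: "composable2 \<pi> \<delta> \<alpha>"
    and "src \<pi> \<delta> = a" and w: "w \<in> V \<alpha>"
  shows "op12 \<pi> sc V X a (cmp \<pi> \<alpha> \<delta>) (tensor_vec sc y \<alpha> w) = tensor_vec sc (X a \<delta> y) \<alpha> w"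
proof -
  have a: "a \<in> Ob \<pi>" and \<delta>: "\<delta> \<in> source_fiber \<pi> a" and \<gamma>: "cmp \<pi> \<alpha> \<delta> \<in> source_fiber \<pi> a"
    using assms by (auto simp: composable2_def source_fiber_def src_in cmp_in src_cmp)
  have lin12: "linear_map_on gscale gscale (VVV (cmp \<pi> \<alpha> \<delta>)) (op12 \<pi> sc V X a (cmp \<pi> \<alpha> \<delta>))"
    using op12_endo[OF X \<gamma>] by (simp add: endo_on_iff)
  have lin: "linear_map_on gscale gscale (VV \<delta>) (X a \<delta>)"
    using X a \<delta> by (auto simp: endo_family_def endo_on_iff)
  show ?thesis
    using y
  proof (induction rule: VV_induct)
    case zero
    show ?case
      using linear_map_on_0[OF lin12 VVV_closed(1)] linear_map_on_0[OF lin VV_closed(1)] by simp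
  next
    case (add x y)
    then show ?case
      using lin12 lin tensor_vec_in_VVV[OF _ c w] by (simp add: linear_map_on_def tensor_vec_add)
  next
    case (scale k x)
    then show ?case
      using lin12 lin tensor_vec_in_VVV[OF _ c w] by (simp add: linear_map_on_def tensor_vec_scale)
  next
    case (pure \<beta>\<^sub>1 \<beta>\<^sub>2 u v)
    have "composable3 \<pi> \<beta>\<^sub>1 \<beta>\<^sub>2 \<alpha>" "src \<pi> \<beta>\<^sub>1 = a"
      using composable3_left[of \<beta>\<^sub>1 \<beta>\<^sub>2 \<alpha>] pure(1,2) c assms(4) by (auto simp: composable2_def src_cmp)
    from op12_spec(2)[OF X a this pure(3,4) w] show ?case
      by (simp add: tensor_vec_pure2 pure(2))
  qed
qed

lemma op23_vec_tensor:
  assumes X: "endo_family X" and y: "y \<in> VV \<delta>" and c: "composable2 \<pi> \<alpha> \<delta>"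
    and "src \<pi> \<alpha> = a" and u: "u \<in> V \<alpha>"
  shows "op23 \<pi> sc V X a (cmp \<pi> \<delta> \<alpha>) (vec_tensor sc \<alpha> u y) = vec_tensor sc \<alpha> u (X (tgt \<pi> \<alpha>) \<delta> y)"
proof -
  have a: "a \<in> Ob \<pi>" and \<delta>: "\<delta> \<in> source_fiber \<pi> (tgt \<pi> \<alpha>)" "tgt \<pi> \<alpha> \<in> Ob \<pi>"
    and \<gamma>: "cmp \<pi> \<delta> \<alpha> \<in> source_fiber \<pi> a"
    using assms by (auto simp: composable2_def source_fiber_def src_in cmp_in src_cmp)
  have lin23: "linear_map_on gscale gscale (VVV (cmp \<pi> \<delta> \<alpha>)) (op23 \<pi> sc V X a (cmp \<pi> \<delta> \<alpha>))"
    using op23_endo[OF X \<gamma>] by (simp add: endo_on_iff)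
  have lin: "linear_map_on gscale gscale (VV \<delta>) (X (tgt \<pi> \<alpha>) \<delta>)"
    using X a \<delta> by (auto simp: endo_family_def endo_on_iff)
  show ?thesis
    using y
  proof (induction rule: VV_induct)
    case zero
    show ?case
      using linear_map_on_0[OF lin23 VVV_closed(1)] linear_map_on_0[OF lin VV_closed(1)] by simp
  next
    case (add x y)
    then show ?case
      using lin23 lin vec_tensor_in_VVV[OF _ c u] by (simp add: linear_map_on_def vec_tensor_add)
  next
    case (scale k x)
    then show ?case
      using lin23 lin vec_tensor_in_VVV[OF _ c u] by (simp add: linear_map_on_def vec_tensor_scale)
  next
    case (pure \<beta>\<^sub>1 \<beta>\<^sub>2 v w)
    have c3: "composable3 \<pi> \<alpha> \<beta>\<^sub>1 \<beta>\<^sub>2"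
      using composable3_right[of \<beta>\<^sub>1 \<beta>\<^sub>2 \<alpha>] pure(1,2) c by simp
    from op23_spec(2)[OF X a this assms(4) u pure(3,4)] show ?case
      by (simp add: vec_tensor_pure2 pure(2) composable3_composite(5)[OF c3])
  qed
qed

text \<open>
  A scalar multiple of the identity on \<open>V \<otimes> V\<close> acts on the threefold product as the same scalar.
  For \<open>op23\<close> the scalars must therefore agree at the targets of all arrows out of \<open>a\<close>.
\<close>
lemma op12_affine:
  assumes X: "endo_family X" and Y: "endo_family Y" and \<gamma>: "\<gamma> \<in> source_fiber \<pi> a"
    and eq: "\<And>\<delta> y. \<lbrakk>\<delta> \<in> source_fiber \<pi> a; y \<in> VV \<delta>\<rbrakk> \<Longrightarrow> Y a \<delta> y = gscale p (X a \<delta> y) + gscale q y"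
    and x: "x \<in> VVV \<gamma>"
  shows "op12 \<pi> sc V Y a \<gamma> x = gscale p (op12 \<pi> sc V X a \<gamma> x) + gscale q x"
proof (rule linear_eq_on_VVV[where F = "op12 \<pi> sc V Y a \<gamma>"
      and G = "\<lambda>x. gscale p (op12 \<pi> sc V X a \<gamma> x) + gscale q x", OF _ _ _ x])
  show "linear_map_on gscale gscale (VVV \<gamma>) (op12 \<pi> sc V Y a \<gamma>)"
    using op12_endo[OF Y \<gamma>] by (simp add: endo_on_iff)
  show "linear_map_on gscale gscale (VVV \<gamma>) (\<lambda>x. gscale p (op12 \<pi> sc V X a \<gamma> x) + gscale q x)"
    using op12_endo[OF X \<gamma>] by (simp add: endo_on_iff linear_map_on_affine)
  fix \<alpha>\<^sub>1 \<alpha>\<^sub>2 \<alpha>\<^sub>3 u v w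
  assume c: "composable3 \<pi> \<alpha>\<^sub>1 \<alpha>\<^sub>2 \<alpha>\<^sub>3" "cmp \<pi> \<alpha>\<^sub>3 (cmp \<pi> \<alpha>\<^sub>2 \<alpha>\<^sub>1) = \<gamma>"
    and uvw: "u \<in> V \<alpha>\<^sub>1" "v \<in> V \<alpha>\<^sub>2" "w \<in> V \<alpha>\<^sub>3"
  have s: "src \<pi> \<alpha>\<^sub>1 = a" and a: "a \<in> Ob \<pi>"
    using composable3_composite(3)[OF c(1)] c(2) \<gamma> source_fiber_Ob[OF \<gamma>] by (auto simp: source_fiber_def)
  have "cmp \<pi> \<alpha>\<^sub>2 \<alpha>\<^sub>1 \<in> source_fiber \<pi> a" "pure2 sc \<alpha>\<^sub>1 \<alpha>\<^sub>2 u v \<in> VV (cmp \<pi> \<alpha>\<^sub>2 \<alpha>\<^sub>1)"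
    using composable3_composite(1)[OF c(1)] s pure2_in_VV c(1) uvw by (auto simp: composable3_def)
  from eq[OF this] show "op12 \<pi> sc V Y a \<gamma> (pure3 sc \<alpha>\<^sub>1 \<alpha>\<^sub>2 \<alpha>\<^sub>3 u v w) =
      gscale p (op12 \<pi> sc V X a \<gamma> (pure3 sc \<alpha>\<^sub>1 \<alpha>\<^sub>2 \<alpha>\<^sub>3 u v w)) + gscale q (pure3 sc \<alpha>\<^sub>1 \<alpha>\<^sub>2 \<alpha>\<^sub>3 u v w)"
    using op12_spec(2)[OF X a c(1) s uvw] op12_spec(2)[OF Y a c(1) s uvw]
    by (simp add: c(2) tensor_vec_add tensor_vec_scale tensor_vec_pure2)
qed

lemma op23_affine:
  assumes X: "endo_family X" and Y: "endo_family Y" and \<gamma>: "\<gamma> \<in> source_fiber \<pi> a"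
    and eq: "\<And>\<alpha> \<delta> y. \<lbrakk>\<alpha> \<in> source_fiber \<pi> a; \<delta> \<in> source_fiber \<pi> (tgt \<pi> \<alpha>); y \<in> VV \<delta>\<rbrakk>
      \<Longrightarrow> Y (tgt \<pi> \<alpha>) \<delta> y = gscale p (X (tgt \<pi> \<alpha>) \<delta> y) + gscale q y"
    and x: "x \<in> VVV \<gamma>"
  shows "op23 \<pi> sc V Y a \<gamma> x = gscale p (op23 \<pi> sc V X a \<gamma> x) + gscale q x"
proof (rule linear_eq_on_VVV[where F = "op23 \<pi> sc V Y a \<gamma>"
      and G = "\<lambda>x. gscale p (op23 \<pi> sc V X a \<gamma> x) + gscale q x", OF _ _ _ x])
  show "linear_map_on gscale gscale (VVV \<gamma>) (op23 \<pi> sc V Y a \<gamma>)"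
    using op23_endo[OF Y \<gamma>] by (simp add: endo_on_iff)
  show "linear_map_on gscale gscale (VVV \<gamma>) (\<lambda>x. gscale p (op23 \<pi> sc V X a \<gamma> x) + gscale q x)"
    using op23_endo[OF X \<gamma>] by (simp add: endo_on_iff linear_map_on_affine)
  fix \<alpha>\<^sub>1 \<alpha>\<^sub>2 \<alpha>\<^sub>3 u v w
  assume c: "composable3 \<pi> \<alpha>\<^sub>1 \<alpha>\<^sub>2 \<alpha>\<^sub>3" "cmp \<pi> \<alpha>\<^sub>3 (cmp \<pi> \<alpha>\<^sub>2 \<alpha>\<^sub>1) = \<gamma>"
    and uvw: "u \<in> V \<alpha>\<^sub>1" "v \<in> V \<alpha>\<^sub>2" "w \<in> V \<alpha>\<^sub>3"
  have s: "src \<pi> \<alpha>\<^sub>1 = a" and a: "a \<in> Ob \<pi>"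
    using composable3_composite(3)[OF c(1)] c(2) \<gamma> source_fiber_Ob[OF \<gamma>] by (auto simp: source_fiber_def)
  have "\<alpha>\<^sub>1 \<in> source_fiber \<pi> a" "cmp \<pi> \<alpha>\<^sub>3 \<alpha>\<^sub>2 \<in> source_fiber \<pi> (tgt \<pi> \<alpha>\<^sub>1)"
    "pure2 sc \<alpha>\<^sub>2 \<alpha>\<^sub>3 v w \<in> VV (cmp \<pi> \<alpha>\<^sub>3 \<alpha>\<^sub>2)"
    using composable3_composite(2)[OF c(1)] s pure2_in_VV c(1) uvw
    by (auto simp: composable3_def composable2_def source_fiber_def)
  from eq[OF this] show "op23 \<pi> sc V Y a \<gamma> (pure3 sc \<alpha>\<^sub>1 \<alpha>\<^sub>2 \<alpha>\<^sub>3 u v w) =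
      gscale p (op23 \<pi> sc V X a \<gamma> (pure3 sc \<alpha>\<^sub>1 \<alpha>\<^sub>2 \<alpha>\<^sub>3 u v w)) + gscale q (pure3 sc \<alpha>\<^sub>1 \<alpha>\<^sub>2 \<alpha>\<^sub>3 u v w)"
    using op23_spec(2)[OF X a c(1) s uvw] op23_spec(2)[OF Y a c(1) s uvw]
    by (simp add: c(2) vec_tensor_add vec_tensor_scale vec_tensor_pure2)
qed

lemma op12_quadratic:
  assumes X: "endo_family X" and \<gamma>: "\<gamma> \<in> source_fiber \<pi> a"
    and eq: "\<And>\<delta> y. \<lbrakk>\<delta> \<in> source_fiber \<pi> a; y \<in> VV \<delta>\<rbrakk>
      \<Longrightarrow> X a \<delta> (X a \<delta> y) = gscale p (X a \<delta> y) + gscale q y"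
    and x: "x \<in> VVV \<gamma>"
  shows "op12 \<pi> sc V X a \<gamma> (op12 \<pi> sc V X a \<gamma> x) = gscale p (op12 \<pi> sc V X a \<gamma> x) + gscale q x"
proof (rule linear_eq_on_VVV[where F = "\<lambda>x. op12 \<pi> sc V X a \<gamma> (op12 \<pi> sc V X a \<gamma> x)"
      and G = "\<lambda>x. gscale p (op12 \<pi> sc V X a \<gamma> x) + gscale q x", OF _ _ _ x])
  show "linear_map_on gscale gscale (VVV \<gamma>) (\<lambda>x. op12 \<pi> sc V X a \<gamma> (op12 \<pi> sc V X a \<gamma> x))"
    using op12_endo[OF X \<gamma>] by (simp add: endo_on_def linear_map_on_def)
  show "linear_map_on gscale gscale (VVV \<gamma>) (\<lambda>x. gscale p (op12 \<pi> sc V X a \<gamma> x) + gscale q x)"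
    using op12_endo[OF X \<gamma>] by (simp add: endo_on_iff linear_map_on_affine)
  fix \<alpha>\<^sub>1 \<alpha>\<^sub>2 \<alpha>\<^sub>3 u v w
  assume c: "composable3 \<pi> \<alpha>\<^sub>1 \<alpha>\<^sub>2 \<alpha>\<^sub>3" "cmp \<pi> \<alpha>\<^sub>3 (cmp \<pi> \<alpha>\<^sub>2 \<alpha>\<^sub>1) = \<gamma>"
    and uvw: "u \<in> V \<alpha>\<^sub>1" "v \<in> V \<alpha>\<^sub>2" "w \<in> V \<alpha>\<^sub>3"
  let ?\<delta> = "cmp \<pi> \<alpha>\<^sub>2 \<alpha>\<^sub>1" and ?t = "pure2 sc \<alpha>\<^sub>1 \<alpha>\<^sub>2 u v"
  have s: "src \<pi> \<alpha>\<^sub>1 = a" and a: "a \<in> Ob \<pi>"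
    using composable3_composite(3)[OF c(1)] c(2) \<gamma> source_fiber_Ob[OF \<gamma>] by (auto simp: source_fiber_def)
  have t: "?\<delta> \<in> source_fiber \<pi> a" "?t \<in> VV ?\<delta>"
    using composable3_composite(1)[OF c(1)] s pure2_in_VV c(1) uvw by (auto simp: composable3_def)
  have "X a ?\<delta> ?t \<in> VV ?\<delta>" "composable2 \<pi> ?\<delta> \<alpha>\<^sub>3" "src \<pi> ?\<delta> = a"
    using X a t composable3_composite(4)[OF c(1)] c(1)
    by (auto simp: endo_family_def endo_on_def source_fiber_def composable3_def composable2_def)
  from op12_tensor_vec[OF X this uvw(3)]
  show "op12 \<pi> sc V X a \<gamma> (op12 \<pi> sc V X a \<gamma> (pure3 sc \<alpha>\<^sub>1 \<alpha>\<^sub>2 \<alpha>\<^sub>3 u v w)) =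
      gscale p (op12 \<pi> sc V X a \<gamma> (pure3 sc \<alpha>\<^sub>1 \<alpha>\<^sub>2 \<alpha>\<^sub>3 u v w)) + gscale q (pure3 sc \<alpha>\<^sub>1 \<alpha>\<^sub>2 \<alpha>\<^sub>3 u v w)"
    using op12_spec(2)[OF X a c(1) s uvw] eq[OF t]
    by (simp add: c(2) tensor_vec_add tensor_vec_scale tensor_vec_pure2)
qed

lemma op23_quadratic:
  assumes X: "endo_family X" and \<gamma>: "\<gamma> \<in> source_fiber \<pi> a"
    and eq: "\<And>\<alpha> \<delta> y. \<lbrakk>\<alpha> \<in> source_fiber \<pi> a; \<delta> \<in> source_fiber \<pi> (tgt \<pi> \<alpha>); y \<in> VV \<delta>\<rbrakk>
      \<Longrightarrow> X (tgt \<pi> \<alpha>) \<delta> (X (tgt \<pi> \<alpha>) \<delta> y) = gscale p (X (tgt \<pi> \<alpha>) \<delta> y) + gscale q y"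
    and x: "x \<in> VVV \<gamma>"
  shows "op23 \<pi> sc V X a \<gamma> (op23 \<pi> sc V X a \<gamma> x) = gscale p (op23 \<pi> sc V X a \<gamma> x) + gscale q x"
proof (rule linear_eq_on_VVV[where F = "\<lambda>x. op23 \<pi> sc V X a \<gamma> (op23 \<pi> sc V X a \<gamma> x)"
      and G = "\<lambda>x. gscale p (op23 \<pi> sc V X a \<gamma> x) + gscale q x", OF _ _ _ x])
  show "linear_map_on gscale gscale (VVV \<gamma>) (\<lambda>x. op23 \<pi> sc V X a \<gamma> (op23 \<pi> sc V X a \<gamma> x))"
    using op23_endo[OF X \<gamma>] by (simp add: endo_on_def linear_map_on_def)
  show "linear_map_on gscale gscale (VVV \<gamma>) (\<lambda>x. gscale p (op23 \<pi> sc V X a \<gamma> x) + gscale q x)"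
    using op23_endo[OF X \<gamma>] by (simp add: endo_on_iff linear_map_on_affine)
  fix \<alpha>\<^sub>1 \<alpha>\<^sub>2 \<alpha>\<^sub>3 u v w
  assume c: "composable3 \<pi> \<alpha>\<^sub>1 \<alpha>\<^sub>2 \<alpha>\<^sub>3" "cmp \<pi> \<alpha>\<^sub>3 (cmp \<pi> \<alpha>\<^sub>2 \<alpha>\<^sub>1) = \<gamma>"
    and uvw: "u \<in> V \<alpha>\<^sub>1" "v \<in> V \<alpha>\<^sub>2" "w \<in> V \<alpha>\<^sub>3"
  let ?\<delta> = "cmp \<pi> \<alpha>\<^sub>3 \<alpha>\<^sub>2" and ?t = "pure2 sc \<alpha>\<^sub>2 \<alpha>\<^sub>3 v w" and ?b = "tgt \<pi> \<alpha>\<^sub>1"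
  have s: "src \<pi> \<alpha>\<^sub>1 = a" and a: "a \<in> Ob \<pi>"
    using composable3_composite(3)[OF c(1)] c(2) \<gamma> source_fiber_Ob[OF \<gamma>] by (auto simp: source_fiber_def)
  have b: "?b \<in> Ob \<pi>"
    using c(1) by (intro tgt_in) (simp add: composable3_def composable2_def)
  have t: "\<alpha>\<^sub>1 \<in> source_fiber \<pi> a" "?\<delta> \<in> source_fiber \<pi> ?b" "?t \<in> VV ?\<delta>"
    using composable3_composite(2)[OF c(1)] s pure2_in_VV c(1) uvw
    by (auto simp: composable3_def composable2_def source_fiber_def)
  have "X ?b ?\<delta> ?t \<in> VV ?\<delta>" "composable2 \<pi> \<alpha>\<^sub>1 ?\<delta>"
    using X b t by (auto simp: endo_family_def endo_on_def source_fiber_def composable2_def)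
  from op23_vec_tensor[OF X this s uvw(1)]
  show "op23 \<pi> sc V X a \<gamma> (op23 \<pi> sc V X a \<gamma> (pure3 sc \<alpha>\<^sub>1 \<alpha>\<^sub>2 \<alpha>\<^sub>3 u v w)) =
      gscale p (op23 \<pi> sc V X a \<gamma> (pure3 sc \<alpha>\<^sub>1 \<alpha>\<^sub>2 \<alpha>\<^sub>3 u v w)) + gscale q (pure3 sc \<alpha>\<^sub>1 \<alpha>\<^sub>2 \<alpha>\<^sub>3 u v w)"
    using op23_spec(2)[OF X a c(1) s uvw] eq[OF t] composable3_composite(5)[OF c(1)]
    by (simp add: c(2) vec_tensor_add vec_tensor_scale vec_tensor_pure2)
qed

end

section \<open>Baxterization\<close>

text \<open>
  Both sides have the factor \<open>f\<^sup>2\<close>; with \<open>s = exp (- 2 (z - w))\<close> and \<open>t = exp (- 2 w)\<close>, the other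
  factors are the two sides of \<open>(1 - s)(1 - t) + (1 - s) t + s (1 - t) = 1 - s t\<close>.
\<close>
lemma exp_baxter_identity:
  fixes f z w :: complex
  defines "p \<equiv> \<lambda>z. exp z - exp (- z)" and "q \<equiv> \<lambda>z. exp (- z) * f"
  shows "p (z - w) * p w * q z * f + p (z - w) * q z * q w + q (z - w) * q z * p w
    = q (z - w) * p z * q w"
proof -
  define x y where "x = exp (z - w)" and "y = exp w"
  have nz: "x \<noteq> 0" "y \<noteq> 0" by (auto simp: x_def y_def)
  have "exp z = x * y" by (simp add: x_def y_def flip: exp_add)
  then have "exp w = y" "exp (- w) = 1 / y" "exp (z - w) = x" "exp (- (z - w)) = 1 / x"
    "exp z = x * y" "exp (- z) = 1 / (x * y)"
    using x_def y_def by (simp_all only: exp_minus inverse_eq_divide)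
  then show ?thesis
    unfolding p_def q_def using nz by (simp only:) (simp add: field_simps power2_eq_square)
qed

text \<open>
  Expand both sides. The cubic terms agree by the braid relation, the terms in \<open>AB\<close> and \<open>BA\<close> have
  equal coefficients, and the quadratic relation turns what remains of the difference into a
  multiple of \<open>B - A\<close>. The hypothesis on the coefficients says that this multiple is zero.
\<close>
lemma baxterization:
  assumes W: "gscale.subspace W" and A: "endo_on W A" and B: "endo_on W B"
    and braid: "\<And>x. x \<in> W \<Longrightarrow> A (B (A x)) = B (A (B x))"
    and A2: "\<And>x. x \<in> W \<Longrightarrow> A (A x) = gscale f (A x) + gscale (- 1) x"
    and B2: "\<And>x. x \<in> W \<Longrightarrow> B (B x) = gscale f (B x) + gscale (- 1) x"
    and coeffs: "p i * p k * q j * f + p i * q j * q k + q i * q j * p k = q i * p j * q k"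
    and RA: "\<And>i x. x \<in> W \<Longrightarrow> RA i x = gscale (p i) (A x) + gscale (q i) x"
    and RB: "\<And>i x. x \<in> W \<Longrightarrow> RB i x = gscale (p i) (B x) + gscale (q i) x"
    and x: "x \<in> W"
  shows "RB i (RA j (RB k x)) = RA k (RB j (RA i x))"
proof -
  note closed = gscale.subspace_add[OF W] gscale.subspace_scale[OF W]
  have AW: "A x \<in> W" "B x \<in> W" if "x \<in> W" for x
    using A B that by (auto simp: endo_on_def)
  have add: "A (x + y) = A x + A y" "B (x + y) = B x + B y" if "x \<in> W" "y \<in> W" for x y
    using A B that by (auto simp: endo_on_def)
  have scale: "A (gscale c x) = gscale c (A x)" "B (gscale c x) = gscale c (B x)" if "x \<in> W" for x c
    using A B that by (auto simp: endo_on_def)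
  have "RB i (RA j (RB k x)) = gscale (p i * p j * p k) (B (A (B x))) + gscale (p i * p j * q k) (B (A x))
      + gscale (q i * p j * p k) (A (B x)) + gscale (p i * q j * p k) (B (B x))
      + gscale (p i * q j * q k + q i * q j * p k) (B x) + gscale (q i * p j * q k) (A x)
      + gscale (q i * q j * q k) x"
    by (simp only: RA RB add scale closed AW x) (simp add: pointwise algebra_simps)
  moreover have "RA k (RB j (RA i x)) = gscale (p i * p j * p k) (A (B (A x))) + gscale (p i * p j * q k) (B (A x))
      + gscale (q i * p j * p k) (A (B x)) + gscale (p i * q j * p k) (A (A x))
      + gscale (p i * q j * q k + q i * q j * p k) (A x) + gscale (q i * p j * q k) (B x)
      + gscale (q i * q j * q k) x"
    by (simp only: RA RB add scale closed AW x) (simp add: pointwise algebra_simps)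
  \<comment> \<open>The differences \<open>B\<^sup>2 - A\<^sup>2 = f(B - A)\<close> and \<open>B - A\<close> cancel by the relation between the coefficients.\<close>
  ultimately show ?thesis
    by (simp only: A2 B2 x braid coeffs[symmetric]) (simp add: pointwise algebra_simps)
qed

theorem theorem1p1:
  fixes \<pi> :: "('o, 'm) groupoid_data"
    and sc :: "complex \<Rightarrow> 'v \<Rightarrow> 'v::ab_group_add"
    and V :: "'m \<Rightarrow> 'v set"
    and f :: "'o \<Rightarrow> complex"
    and \<sigma> :: "'o \<Rightarrow> ('m, ('m, 'v) gtens2) fiber_op"
  defines "VV \<equiv> graded_tensor2 \<pi> sc V V"
    and "VVV \<equiv> graded_tensor3 \<pi> sc V V V"
  assumes "groupoid \<pi>"
    and "graded_finite_type \<pi> sc V"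
    and "\<forall>a\<in>Ob \<pi>. f a \<noteq> 0"
    and "\<forall>a\<in>Ob \<pi>. fiber_invertible \<pi> VV a (\<sigma> a)"
    and "\<forall>a\<in>Ob \<pi>. fiber_eq \<pi> VVV a
           (op12 \<pi> sc V \<sigma> a \<odot> op23 \<pi> sc V \<sigma> a \<odot> op12 \<pi> sc V \<sigma> a)
           (op23 \<pi> sc V \<sigma> a \<odot> op12 \<pi> sc V \<sigma> a \<odot> op23 \<pi> sc V \<sigma> a)"
    and "\<forall>a\<in>Ob \<pi>. fiber_eq \<pi> VV a
           (\<sigma> a + fiber_inv VV (\<sigma> a)) (fiber_scale (f a) fiber_id)"
    and "\<forall>\<alpha>\<in>Arr \<pi>. f (src \<pi> \<alpha>) = f (tgt \<pi> \<alpha>)"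
  shows "\<forall>a\<in>Ob \<pi>. \<forall>z w. fiber_eq \<pi> VVV a
           (op23 \<pi> sc V (R_check VV \<sigma> (z - w)) a \<odot> op12 \<pi> sc V (R_check VV \<sigma> z) a
              \<odot> op23 \<pi> sc V (R_check VV \<sigma> w) a)
           (op12 \<pi> sc V (R_check VV \<sigma> w) a \<odot> op23 \<pi> sc V (R_check VV \<sigma> z) a
              \<odot> op12 \<pi> sc V (R_check VV \<sigma> (z - w)) a)"
proof -
  interpret graded_space \<pi> sc V
    using assms(3,4) by (intro graded_space.intro graded_space_axioms.intro)
  note VV_def [simp] VVV_def [simp]
  \<comment> \<open>\<open>R(z) = p z \<sigma> + q z\<close>, after eliminating \<open>\<sigma>\<^sup>-\<^sup>1 = f - \<sigma>\<close>.\<close>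
  define p where "p z = exp z - exp (- z)" for z :: complex
  define q where "q b z = exp (- z) * f b" for b and z :: complex
  have \<sigma>: "endo_family \<sigma>"
    using assms(6) by (auto simp: endo_family_def fiber_invertible_def fiber_End_def)
  have inv: "fiber_inv VV (\<sigma> b) \<delta> y = gscale (f b) y + gscale (- 1) (\<sigma> b \<delta> y)"
    if "b \<in> Ob \<pi>" "\<delta> \<in> source_fiber \<pi> b" "y \<in> VV \<delta>" for b \<delta> y
  proof -
    have "\<sigma> b \<delta> y + fiber_inv VV (\<sigma> b) \<delta> y = gscale (f b) y"
      using assms(8) that by (simp add: fiber_eq_def fiber_scale_def fiber_id_def plus_fun_apply)
    then have "fiber_inv VV (\<sigma> b) \<delta> y = gscale (f b) y - \<sigma> b \<delta> y"
      by (metis add_diff_cancel_left')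
    then show ?thesis by (simp add: pointwise)
  qed
  have quadratic: "\<sigma> b \<delta> (\<sigma> b \<delta> y) = gscale (f b) (\<sigma> b \<delta> y) + gscale (- 1) y"
    if "b \<in> Ob \<pi>" "\<delta> \<in> source_fiber \<pi> b" "y \<in> VV \<delta>" for b \<delta> y
  proof -
    have "fiber_invertible \<pi> VV b (\<sigma> b)"
      using assms(6) that(1) by (rule bspec)
    then obtain Y where "fiber_eq \<pi> VV b (Y \<odot> \<sigma> b) fiber_id"
      unfolding fiber_invertible_def by (elim conjE bexE)
    then have "Y \<delta> (\<sigma> b \<delta> x) = x" if "x \<in> VV \<delta>" for x
      using \<open>\<delta> \<in> source_fiber \<pi> b\<close> that by (simp add: fiber_eq_def fiber_comp_def fiber_id_def)
    then have "inj_on (\<sigma> b \<delta>) (VV \<delta>)"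
      by (rule inj_on_inverseI[where g = "Y \<delta>"])
    then have inverse: "fiber_inv VV (\<sigma> b) \<delta> (\<sigma> b \<delta> y) = y"
      using that(3) by (simp add: fiber_inv_def)
    have "\<sigma> b \<delta> y \<in> VV \<delta>"
      using \<sigma> that by (auto simp: endo_family_def endo_on_def)
    from inv[OF that(1,2) this] have "y = gscale (f b) (\<sigma> b \<delta> y) + gscale (- 1) (\<sigma> b \<delta> (\<sigma> b \<delta> y))"
      unfolding inverse .
    then show ?thesis by (rule gscale_minus_swap)
  qed
  have R: "R_check VV \<sigma> z b \<delta> y = gscale (p z) (\<sigma> b \<delta> y) + gscale (q b z) y"
    if "b \<in> Ob \<pi>" "\<delta> \<in> source_fiber \<pi> b" "y \<in> VV \<delta>" for z b \<delta> y
  proof -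
    have "R_check VV \<sigma> z b \<delta> y =
        gscale (exp z) (\<sigma> b \<delta> y) + gscale (exp (- z)) (fiber_inv VV (\<sigma> b) \<delta> y)"
      by (simp add: R_check_def fiber_scale_def plus_fun_apply)
    also have "\<dots> = gscale (p z) (\<sigma> b \<delta> y) + gscale (q b z) y"
      unfolding inv[OF that] by (simp add: p_def q_def pointwise algebra_simps)
    finally show ?thesis .
  qed
  have R_endo: "endo_family (R_check VV \<sigma> z)" for z
    unfolding endo_family_def
  proof (intro ballI)
    fix b \<delta> assume b: "b \<in> Ob \<pi>" "\<delta> \<in> source_fiber \<pi> b"
    then have "endo_on (VV \<delta>) (\<sigma> b \<delta>)" using \<sigma> by (simp add: endo_family_def)
    then show "endo_on (graded_tensor2 \<pi> sc V V \<delta>) (R_check VV \<sigma> z b \<delta>)"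
      using endo_on_affine[OF subspace_VV, of \<delta> "\<sigma> b \<delta>" "p z" "q b z"] R[OF b]
      by (simp add: endo_on_def VV_closed)
  qed
  show ?thesis
    unfolding fiber_eq_def
  proof (intro ballI allI)
    fix a z w \<gamma> x
    assume a: "a \<in> Ob \<pi>" and \<gamma>: "\<gamma> \<in> source_fiber \<pi> a" and x: "x \<in> VVV \<gamma>"
    have tgt: "tgt \<pi> \<alpha> \<in> Ob \<pi>" "f (tgt \<pi> \<alpha>) = f a" if "\<alpha> \<in> source_fiber \<pi> a" for \<alpha>
      using that assms(9) tgt_in by (auto simp: source_fiber_def)
    have "op23 \<pi> sc V (R_check VV \<sigma> (z - w)) a \<gamma> (op12 \<pi> sc V (R_check VV \<sigma> z) a \<gamma>
          (op23 \<pi> sc V (R_check VV \<sigma> w) a \<gamma> x)) =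
        op12 \<pi> sc V (R_check VV \<sigma> w) a \<gamma> (op23 \<pi> sc V (R_check VV \<sigma> z) a \<gamma>
          (op12 \<pi> sc V (R_check VV \<sigma> (z - w)) a \<gamma> x))"
    proof (rule baxterization[where W = "VVV \<gamma>" and A = "op12 \<pi> sc V \<sigma> a \<gamma>" and B = "op23 \<pi> sc V \<sigma> a \<gamma>"
          and RA = "\<lambda>z. op12 \<pi> sc V (R_check VV \<sigma> z) a \<gamma>"
          and RB = "\<lambda>z. op23 \<pi> sc V (R_check VV \<sigma> z) a \<gamma>"
          and p = p and q = "q a" and f = "f a" and i = "z - w" and j = z and k = w])
      show "gscale.subspace (VVV \<gamma>)" by (simp add: subspace_VVV)
      show "endo_on (VVV \<gamma>) (op12 \<pi> sc V \<sigma> a \<gamma>)" "endo_on (VVV \<gamma>) (op23 \<pi> sc V \<sigma> a \<gamma>)"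
        using op12_endo[OF \<sigma> \<gamma>] op23_endo[OF \<sigma> \<gamma>] by simp_all
      show "x \<in> VVV \<gamma>" by fact
      show "p (z - w) * p w * q a z * f a + p (z - w) * q a z * q a w + q a (z - w) * q a z * p w
          = q a (z - w) * p z * q a w"
        unfolding p_def q_def by (rule exp_baxter_identity)
    next
      fix x assume x: "x \<in> VVV \<gamma>"
      show "op12 \<pi> sc V \<sigma> a \<gamma> (op23 \<pi> sc V \<sigma> a \<gamma> (op12 \<pi> sc V \<sigma> a \<gamma> x)) =
          op23 \<pi> sc V \<sigma> a \<gamma> (op12 \<pi> sc V \<sigma> a \<gamma> (op23 \<pi> sc V \<sigma> a \<gamma> x))"
        using assms(7) a \<gamma> x by (simp add: fiber_eq_def fiber_comp_def)
      show "op12 \<pi> sc V \<sigma> a \<gamma> (op12 \<pi> sc V \<sigma> a \<gamma> x) =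
          gscale (f a) (op12 \<pi> sc V \<sigma> a \<gamma> x) + gscale (- 1) x"
        by (rule op12_quadratic[OF \<sigma> \<gamma>]) (use quadratic a x in simp_all)
      show "op23 \<pi> sc V \<sigma> a \<gamma> (op23 \<pi> sc V \<sigma> a \<gamma> x) =
          gscale (f a) (op23 \<pi> sc V \<sigma> a \<gamma> x) + gscale (- 1) x"
        by (rule op23_quadratic[OF \<sigma> \<gamma>]) (use quadratic tgt x in simp_all)
      show "op12 \<pi> sc V (R_check VV \<sigma> i) a \<gamma> x =
          gscale (p i) (op12 \<pi> sc V \<sigma> a \<gamma> x) + gscale (q a i) x" for i
        by (rule op12_affine[OF \<sigma> R_endo \<gamma>]) (use R a x in simp_all)
      show "op23 \<pi> sc V (R_check VV \<sigma> i) a \<gamma> x =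
          gscale (p i) (op23 \<pi> sc V \<sigma> a \<gamma> x) + gscale (q a i) x" for i
        by (rule op23_affine[OF \<sigma> R_endo \<gamma>]) (use R tgt x in \<open>simp_all add: q_def\<close>)
    qed
    then show "(op23 \<pi> sc V (R_check VV \<sigma> (z - w)) a \<odot> op12 \<pi> sc V (R_check VV \<sigma> z) a
              \<odot> op23 \<pi> sc V (R_check VV \<sigma> w) a) \<gamma> x =
           (op12 \<pi> sc V (R_check VV \<sigma> w) a \<odot> op23 \<pi> sc V (R_check VV \<sigma> z) a
              \<odot> op12 \<pi> sc V (R_check VV \<sigma> (z - w)) a) \<gamma> x"
      by (simp add: fiber_comp_def)
  qed
qed

end
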